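(* Let $\alpha$ be a smooth function of involutive and generic type, and let $F_1\colon I_1\times J_1\to\mathbb R^3$ be the map associated with the integral manifold $S_1$ determined by smooth functions $\xi(t),\mu(t)$ as described in the context. If a point $(s_0,t_0)\in S(F_1)$ satisfies $$\xi'''(t_0)+\left(\widetilde{\overline{x(\alpha_q+\alpha\alpha_p)}}\right)_t(s_0,t_0)\neq0,$$ then $F_1$ is a cuspidal edge at $(s_0,t_0)$.
   Context: All objects are $C^\infty$ and all considerations are local. $(x,y,z,p,q)$ are canonical coordinates on $J^1(2,1)=PT^*J^0(2,1)$, $\dim J^0(2,1)=3$, in which the contact form is $dz-p\,dx-q\,dy$; $J^0(2,1)$ is locally identified with $\mathbb R^3$ via $(x,y,z)$. The function $\alpha=\alpha(x,y,z,p,q)$ is of involutive type if $\alpha_x+p\alpha_z-\alpha(\alpha_y+q\alpha_z)=0$ on its domain, and of generic type if $1+x(\alpha_y+q\alpha_z)\ne0$. Define the local diffeomorphism $\Phi_1(x,y,z,p,q)=(x_0,\dots,x_4)=(x,\ y+\alpha x,\ z-px-qy,\ p,\ q)$, with a local inverse $\Phi_1^{-1}$ on an open set $V_1\subset\mathbb R\times U_1$ (product of an open interval and an open $U_1\subset\mathbb R^4$); let $\varphi_1,\psi_1$ be its second ($y$) and third ($z$) components. The function $\overline\alpha=\alpha\circ\Phi_1^{-1}$ does not depend on $x_0$ and is regarded as a function of $(x_1,x_2,x_3,x_4)$. Let $\xi(t)$ be a smooth function and $\mu(t)$ a solution of $\mu'(t)=\overline\alpha(-\xi'(t),\xi(t),\mu(t),t)$.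 For open intervals $I_1,J_1$ with $(s,-\xi'(t),\xi(t),\mu(t),t)\in V_1$ for $(s,t)\in I_1\times J_1$, put $\Theta_1(s,t)=\Phi_1^{-1}(s,-\xi'(t),\xi(t),\mu(t),t)$; its image $S_1$ is a two-dimensional integral manifold of the ideal generated by $dz-p\,dx-q\,dy$, $dp-\alpha\,dq$ and their exterior derivatives. For a function $g$ of $(x,y,z,p,q)$ write $\widetilde{\overline g}=g\circ\Theta_1\colon I_1\times J_1\to\mathbb R$. The map associated with $S_1$ is $$F_1(s,t)=(s,\ \varphi_1(s,-\xi'(t),\xi(t),\mu(t),t),\ \psi_1(s,-\xi'(t),\xi(t),\mu(t),t)),$$ and $S(F_1)$ is the set of its singular points (where $\mathrm{rank}\,dF_1<2$). Two map germs $f\colon(\mathbb R^2,a)\to(\mathbb R^3,f(a))$, $g\colon(\mathbb R^2,b)\to(\mathbb R^3,g(b))$ are right-left equivalent if $\psi\circ f=g\circ\varphi$ for some diffeomorphism germs $\varphi\colon(\mathbb R^2,a)\to(\mathbb R^2,b)$ and $\psi\colon(\mathbb R^3,f(a))\to(\mathbb R^3,g(b))$. A map is a cuspidal edge at a point if its germ there is right-left equivalent to the germ at the origin of $(u,v)\mapsto(u,v^2,v^3)$. *)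

theory Defs
  imports "HOL-Analysis.Analysis"
begin

text \<open>
  \<open>smooth_on S f\<close> is intended for open \<open>S\<close> in a finite-dimensional space, where it means that \<open>f\<close>
  is \<open>C\<^sup>\<infinity>\<close> on \<open>S\<close>. Functions are total; their values outside \<open>S\<close> are irrelevant.
\<close>

primrec Ck_on :: "nat \<Rightarrow> 'a::euclidean_space set \<Rightarrow> ('a \<Rightarrow> 'b::euclidean_space) \<Rightarrow> bool" where
  "Ck_on 0 S f \<longleftrightarrow> continuous_on S f"
| "Ck_on (Suc k) S f \<longleftrightarrow>
     (\<forall>x\<in>S. f differentiable (at x)) \<and>
     (\<forall>v. Ck_on k S (\<lambda>x. frechet_derivative f (at x) v))"

definition smooth_on :: "'a::euclidean_space set \<Rightarrow> ('a \<Rightarrow> 'b::euclidean_space) \<Rightarrow> bool" where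
  "smooth_on S f \<longleftrightarrow> (\<forall>k. Ck_on k S f)"

definition diffeomorphism ::
    "'a::euclidean_space set \<Rightarrow> 'b::euclidean_space set \<Rightarrow> ('a \<Rightarrow> 'b) \<Rightarrow> ('b \<Rightarrow> 'a) \<Rightarrow> bool" where
  "diffeomorphism U V f g \<longleftrightarrow>
     open U \<and> open V \<and> homeomorphism U V f g \<and> smooth_on U f \<and> smooth_on V g"

text \<open>
  The germs are represented by maps on neighbourhoods; \<open>U\<close> is chosen small enough that the
  composite \<open>\<psi> \<circ> f\<close> is defined on it.
\<close>

definition right_left_equivalent ::
    "('a::euclidean_space \<Rightarrow> 'b::euclidean_space) \<Rightarrow> 'a \<Rightarrow> ('a \<Rightarrow> 'b) \<Rightarrow> 'a \<Rightarrow> bool" where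
  "right_left_equivalent f a g b \<longleftrightarrow>
     (\<exists>U U' W W' \<phi> \<phi>' \<psi> \<psi>'.
        diffeomorphism U U' \<phi> \<phi>' \<and> a \<in> U \<and> \<phi> a = b \<and>
        diffeomorphism W W' \<psi> \<psi>' \<and> f a \<in> W \<and> \<psi> (f a) = g b \<and>
        f ` U \<subseteq> W \<and> (\<forall>x\<in>U. \<psi> (f x) = g (\<phi> x)))"

definition cuspidal_edge_at :: "(real \<times> real \<Rightarrow> real \<times> real \<times> real) \<Rightarrow> real \<times> real \<Rightarrow> bool" where
  "cuspidal_edge_at f a \<longleftrightarrow> right_left_equivalent f a (\<lambda>(u, v). (u, v ^ 2, v ^ 3)) (0, 0)"

definition singular_set ::
    "'a::euclidean_space set \<Rightarrow> ('a \<Rightarrow> 'b::euclidean_space) \<Rightarrow> 'a set" where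
  "singular_set A F = {P \<in> A. dim (range (frechet_derivative F (at P))) < DIM('a)}"

text \<open>Points of the jet space are written \<open>(x, y, z, p, q)\<close>.\<close>

type_synonym real4 = "real \<times> real \<times> real \<times> real"
type_synonym jet = "real \<times> real \<times> real \<times> real \<times> real"

fun D_x :: "(jet \<Rightarrow> real) \<Rightarrow> jet \<Rightarrow> real" where
  "D_x f (x, y, z, p, q) = deriv (\<lambda>r. f (r, y, z, p, q)) x"

fun D_y :: "(jet \<Rightarrow> real) \<Rightarrow> jet \<Rightarrow> real" where
  "D_y f (x, y, z, p, q) = deriv (\<lambda>r. f (x, r, z, p, q)) y"

fun D_z :: "(jet \<Rightarrow> real) \<Rightarrow> jet \<Rightarrow> real" where
  "D_z f (x, y, z, p, q) = deriv (\<lambda>r. f (x, y, r, p, q)) z"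

fun D_p :: "(jet \<Rightarrow> real) \<Rightarrow> jet \<Rightarrow> real" where
  "D_p f (x, y, z, p, q) = deriv (\<lambda>r. f (x, y, z, r, q)) p"

fun D_q :: "(jet \<Rightarrow> real) \<Rightarrow> jet \<Rightarrow> real" where
  "D_q f (x, y, z, p, q) = deriv (\<lambda>r. f (x, y, z, p, r)) q"

definition involutive_type :: "jet set \<Rightarrow> (jet \<Rightarrow> real) \<Rightarrow> bool" where
  "involutive_type D \<alpha> \<longleftrightarrow>
     (\<forall>(x, y, z, p, q) \<in> D. let P = (x, y, z, p, q) in
        D_x \<alpha> P + p * D_z \<alpha> P - \<alpha> P * (D_y \<alpha> P + q * D_z \<alpha> P) = 0)"

definition generic_type :: "jet set \<Rightarrow> (jet \<Rightarrow> real) \<Rightarrow> bool" where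
  "generic_type D \<alpha> \<longleftrightarrow>
     (\<forall>(x, y, z, p, q) \<in> D. let P = (x, y, z, p, q) in
        1 + x * (D_y \<alpha> P + q * D_z \<alpha> P) \<noteq> 0)"

fun Phi1 :: "(jet \<Rightarrow> real) \<Rightarrow> jet \<Rightarrow> real \<times> real4" where
  "Phi1 \<alpha> (x, y, z, p, q) = (x, y + \<alpha> (x, y, z, p, q) * x, z - p * x - q * y, p, q)"

text \<open>
  Below, \<open>G\<close> is a local inverse of \<^term>\<open>Phi1 \<alpha>\<close> on the product \<open>K \<times> U\<close> of an open interval and
  an open set.
\<close>

definition local_inverse_Phi1 ::
    "jet set \<Rightarrow> (jet \<Rightarrow> real) \<Rightarrow> real set \<Rightarrow> real4 set \<Rightarrow> (real \<times> real4 \<Rightarrow> jet) \<Rightarrow> bool" where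
  "local_inverse_Phi1 D \<alpha> K U G \<longleftrightarrow>
     open K \<and> is_interval K \<and> open U \<and>
     (\<exists>W. W \<subseteq> D \<and> diffeomorphism W (K \<times> U) (Phi1 \<alpha>) G)"

text \<open>
  The common value of \<open>\<alpha> \<circ> G\<close> on the slice \<open>K \<times> {u}\<close>. It exists for \<open>u \<in> U\<close> because \<open>\<alpha>\<close> is of
  involutive and generic type.
\<close>

definition alpha_bar ::
    "(jet \<Rightarrow> real) \<Rightarrow> real set \<Rightarrow> (real \<times> real4 \<Rightarrow> jet) \<Rightarrow> real4 \<Rightarrow> real" where
  "alpha_bar \<alpha> K G u = (THE c. \<forall>x0\<in>K. \<alpha> (G (x0, u)) = c)"

fun lift1 :: "(real \<Rightarrow> real) \<Rightarrow> (real \<Rightarrow> real) \<Rightarrow> real \<times> real \<Rightarrow> real \<times> real4" where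
  "lift1 \<xi> \<mu> (s, t) = (s, - deriv \<xi> t, \<xi> t, \<mu> t, t)"

definition Theta1 ::
    "(real \<times> real4 \<Rightarrow> jet) \<Rightarrow> (real \<Rightarrow> real) \<Rightarrow> (real \<Rightarrow> real) \<Rightarrow> real \<times> real \<Rightarrow> jet" where
  "Theta1 G \<xi> \<mu> = G \<circ> lift1 \<xi> \<mu>"

definition phi1 :: "(real \<times> real4 \<Rightarrow> jet) \<Rightarrow> real \<times> real4 \<Rightarrow> real" where
  "phi1 G v = (case G v of (x, y, z, p, q) \<Rightarrow> y)"

definition psi1 :: "(real \<times> real4 \<Rightarrow> jet) \<Rightarrow> real \<times> real4 \<Rightarrow> real" where
  "psi1 G v = (case G v of (x, y, z, p, q) \<Rightarrow> z)"

definition F1 ::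
    "(real \<times> real4 \<Rightarrow> jet) \<Rightarrow> (real \<Rightarrow> real) \<Rightarrow> (real \<Rightarrow> real) \<Rightarrow> real \<times> real \<Rightarrow> real \<times> real \<times> real" where
  "F1 G \<xi> \<mu> = (\<lambda>(s, t). (s, phi1 G (lift1 \<xi> \<mu> (s, t)), psi1 G (lift1 \<xi> \<mu> (s, t))))"

end

theory Submission
  imports Defs
begin

text \<open>
  Since \<open>\<alpha>\<close> is of involutive and generic type, it is constant along the lines \<open>x\<^sub>0 \<mapsto> G (x\<^sub>0, u)\<close>. With
  \<open>h (s, t) = \<xi> t + s * \<mu> t\<close> the map \<open>F\<^sub>1\<close> is therefore \<open>(s, - h\<^sub>t, h - t * h\<^sub>t)\<close>, whose singular points are the
  zeros of \<open>h\<^sub>t\<^sub>t\<close>. Differentiating \<open>\<alpha> \<circ> \<Theta>\<^sub>1 = \<mu>'\<close> gives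
  \<open>\<xi>'' + x (\<alpha>\<^sub>q + \<alpha> \<alpha>\<^sub>p) = (1 + x (\<alpha>\<^sub>y + q \<alpha>\<^sub>z)) h\<^sub>t\<^sub>t\<close>, so the hypothesis forces \<open>h\<^sub>t\<^sub>t\<^sub>t \<noteq> 0\<close> at the singular point.

  For the normal form, a smooth function \<open>g\<close> of one variable satisfies
  \<open>g (\<sigma> + w) = g \<sigma> + w g' \<sigma> + w\<^sup>2 Q (\<sigma>, w\<^sup>2) + w\<^sup>3 P (\<sigma>, w\<^sup>2)\<close> locally, with \<open>Q\<close> and \<open>P\<close> smooth on the
  whole plane (Whitney's theorem on even functions, with Seeley's reflection for negative second argument).
  The implicit function theorem yields \<open>\<sigma> (s, l)\<close> such that the odd part of \<open>h\<^sub>t (s, \<sigma> (s, l) + w)\<close> vanishes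
  whenever \<open>w\<^sup>2 = l\<close>. Then \<open>F\<^sub>1 (s, \<sigma> (s, w\<^sup>2) + w) = \<Psi> (s, w\<^sup>2, w\<^sup>3)\<close> with
  \<open>\<Psi> (s, l, k) = (s, Y (s, l), M (s, l) + k N (s, l))\<close>, and \<open>h\<^sub>t\<^sub>t\<^sub>t \<noteq> 0\<close> makes \<open>Y\<^sub>l\<close> and \<open>N\<close> nonzero, so that
  \<open>\<Psi>\<close> is a local diffeomorphism.
\<close>

subsection \<open>Calculus of smooth functions\<close>

lemma Ck_on_subset: "Ck_on k S f \<Longrightarrow> T \<subseteq> S \<Longrightarrow> Ck_on k T f"
  by (induction k arbitrary: f) (auto intro: continuous_on_subset)

text \<open>\<open>frechet_derivative\<close> is a Hilbert choice, so a common derivative is not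
  enough: the predicates behind the choice are shown to agree for every candidate, which also covers
  points without differentiability.\<close>

lemma frechet_derivative_cong_open:
  assumes "open S" "x \<in> S" "\<And>y. y \<in> S \<Longrightarrow> f y = g y"
  shows "frechet_derivative f (at x) = frechet_derivative g (at x)"
proof -
  have "(f has_derivative f') (at x) = (g has_derivative f') (at x)" for f'
    using assms has_derivative_transform_within_open by metis
  then show ?thesis unfolding frechet_derivative_def by simp
qed

lemma Ck_on_cong:
  assumes "open S" "\<And>y. y \<in> S \<Longrightarrow> f y = g y" "Ck_on k S f"
  shows "Ck_on k S g"
  using assms(2,3)
proof (induction k arbitrary: f g)
  case 0
  then show ?case using continuous_on_eq[of S f g] by simp
next
  case (Suc k)
  have "g differentiable at x" if "x \<in> S" for x
    by (meson Suc.prems assms(1) that Ck_on.simps(2) differentiable_def has_derivative_transform_within_open)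
  moreover have "Ck_on k S (\<lambda>x. frechet_derivative g (at x) v)" for v
    by (rule Suc.IH[of "\<lambda>x. frechet_derivative f (at x) v"])
      (use Suc.prems frechet_derivative_cong_open[OF assms(1), of _ f g] in auto)
  ultimately show ?case by simp
qed

text \<open>Derivatives are unique, so the chosen \<open>frechet_derivative\<close> can be traded
  for any explicit formula; most inductions on the order below rest on this.\<close>

lemma Ck_on_SucI:
  assumes "open S" "\<And>x. x \<in> S \<Longrightarrow> (f has_derivative f' x) (at x)"
    and "\<And>v. Ck_on k S (\<lambda>x. f' x v)"
  shows "Ck_on (Suc k) S f"
proof -
  have "frechet_derivative f (at x) = f' x" if "x \<in> S" for x
    using assms(2)[OF that] frechet_derivative_at by metis
  then show ?thesis
    using assms by (auto simp: differentiable_def intro: Ck_on_cong[OF assms(1) _ assms(3)])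
qed

lemma Ck_on_imp_derivative:
  "Ck_on (Suc k) S f \<Longrightarrow> x \<in> S \<Longrightarrow> (f has_derivative frechet_derivative f (at x)) (at x)"
  by (simp add: frechet_derivative_works)

lemma Ck_on_SucD: "Ck_on (Suc k) S f \<Longrightarrow> Ck_on k S f"
proof (induction k arbitrary: f)
  case 0
  then show ?case
    by (auto intro!: continuous_at_imp_continuous_on differentiable_imp_continuous_within)
next
  case (Suc k)
  then show ?case by simp
qed

lemma Ck_on_const: "Ck_on k S (\<lambda>x. c)"
proof (induction k arbitrary: c)
  case (Suc k)
  have "frechet_derivative (\<lambda>x. c) (at x) = (\<lambda>v. 0)" for x :: 'a
    by (metis frechet_derivative_at has_derivative_const)
  then show ?case using Suc by simp
qed simp

lemma Ck_on_linear_compose: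
  assumes "open S" "bounded_linear L"
  shows "Ck_on k S f \<Longrightarrow> Ck_on k S (\<lambda>x. L (f x))"
proof (induction k arbitrary: f)
  case 0
  then show ?case using assms(2) by (auto intro: bounded_linear.continuous_on)
next
  case (Suc k)
  show ?case
    by (rule Ck_on_SucI[OF assms(1) bounded_linear.has_derivative[OF assms(2) Ck_on_imp_derivative[OF Suc.prems]]])
       (use Suc in auto)
qed

lemma Ck_on_add:
  assumes "open S"
  shows "Ck_on k S f \<Longrightarrow> Ck_on k S g \<Longrightarrow> Ck_on k S (\<lambda>x. f x + g x)"
proof (induction k arbitrary: f g)
  case 0
  then show ?case by (auto intro: continuous_on_add)
next
  case (Suc k)
  show ?case
    by (rule Ck_on_SucI[OF assms has_derivative_add[OF Ck_on_imp_derivative[OF Suc.prems(1)] Ck_on_imp_derivative[OF Suc.prems(2)]]])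
       (use Suc in auto)
qed

lemma Ck_on_bilinear:
  assumes "open S" "bounded_bilinear m"
  shows "Ck_on k S f \<Longrightarrow> Ck_on k S g \<Longrightarrow> Ck_on k S (\<lambda>x. m (f x) (g x))"
proof (induction k arbitrary: f g)
  case 0
  then show ?case using assms(2) by (auto intro: bounded_bilinear.continuous_on)
next
  case (Suc k)
  show ?case
    by (rule Ck_on_SucI[OF assms(1) bounded_bilinear.FDERIV[OF assms(2) Ck_on_imp_derivative[OF Suc.prems(1)] Ck_on_imp_derivative[OF Suc.prems(2)]]])
       (use Suc.prems[THEN Ck_on_SucD] Suc in \<open>auto intro!: Ck_on_add assms\<close>)
qed

lemma Ck_on_sum:
  assumes "open S" "finite I" "\<And>i. i \<in> I \<Longrightarrow> Ck_on k S (f i)"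
  shows "Ck_on k S (\<lambda>x. \<Sum>i\<in>I. f i x)"
  using assms(2,3) by (induction rule: finite_induct) (auto intro: Ck_on_const Ck_on_add assms(1))

lemma Ck_on_compose:
  assumes "open S" "open T" "f ` S \<subseteq> T"
  shows "Ck_on k S f \<Longrightarrow> Ck_on k T g \<Longrightarrow> Ck_on k S (\<lambda>x. g (f x))"
proof (induction k arbitrary: g)
  case 0
  then show ?case using continuous_on_compose2[OF _ _ assms(3), of g] by simp
next
  case (Suc k)
  have fS: "f x \<in> T" if "x \<in> S" for x using assms that by auto
  \<comment> \<open>The chain rule evaluates the derivative of \<open>g\<close> in a moving
    direction, whereas \<open>Ck_on\<close> controls fixed directions only. Expanding along the
    basis leaves products of functions that the induction hypothesis reaches.\<close>
  define d where "d x v = (\<Sum>b\<in>Basis. (frechet_derivative f (at x) v \<bullet> b) *\<^sub>R frechet_derivative g (at (f x)) b)" for x v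
  have dg: "(g has_derivative frechet_derivative g (at y)) (at y)" if "y \<in> T" for y
    using Ck_on_imp_derivative[OF Suc.prems(2) that] .
  have "((\<lambda>x. g (f x)) has_derivative d x) (at x)" if x: "x \<in> S" for x
  proof -
    have c: "((\<lambda>x. g (f x)) has_derivative (\<lambda>v. frechet_derivative g (at (f x)) (frechet_derivative f (at x) v))) (at x)"
      using diff_chain_at[OF Ck_on_imp_derivative[OF Suc.prems(1) x] dg[OF fS[OF x]]] by (simp add: o_def)
    have e: "frechet_derivative g (at (f x)) w = (\<Sum>b\<in>Basis. (w \<bullet> b) *\<^sub>R frechet_derivative g (at (f x)) b)" for w
    proof -
      interpret linear "frechet_derivative g (at (f x))"
        using has_derivative_linear[OF dg[OF fS[OF x]]] .
      have "frechet_derivative g (at (f x)) (\<Sum>b\<in>Basis. (w \<bullet> b) *\<^sub>R b)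
          = (\<Sum>b\<in>Basis. (w \<bullet> b) *\<^sub>R frechet_derivative g (at (f x)) b)"
        by (simp only: sum scale)
      then show ?thesis by (simp add: euclidean_representation)
    qed
    have "d x = (\<lambda>v. frechet_derivative g (at (f x)) (frechet_derivative f (at x) v))"
      by (rule ext, subst e) (simp only: d_def)
    then show ?thesis using c by simp
  qed
  moreover have "Ck_on k S (\<lambda>x. d x v)" for v
    unfolding d_def
  proof (intro Ck_on_sum assms(1) finite_Basis)
    fix b :: 'b assume "b \<in> Basis"
    have "Ck_on k S (\<lambda>x. frechet_derivative f (at x) v \<bullet> b)"
      by (rule Ck_on_linear_compose[OF assms(1) bounded_linear_inner_left]) (use Suc.prems(1) in simp)
    moreover have "Ck_on k S (\<lambda>x. frechet_derivative g (at (f x)) b)"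
      using Suc.IH[OF Ck_on_SucD[OF Suc.prems(1)], of "\<lambda>y. frechet_derivative g (at y) b"] Suc.prems(2) by simp
    ultimately show "Ck_on k S (\<lambda>x. (frechet_derivative f (at x) v \<bullet> b) *\<^sub>R frechet_derivative g (at (f x)) b)"
      by (rule Ck_on_bilinear[OF assms(1) bounded_bilinear_scaleR])
  qed
  ultimately show ?case by (rule Ck_on_SucI[OF assms(1)])
qed

lemma Ck_on_inverse: "Ck_on k (- {0}) (inverse :: real \<Rightarrow> real)"
proof (induction k)
  case (Suc k)
  have o: "open (- {0::real})" by auto
  show ?case
  proof (rule Ck_on_SucI[OF o])
    fix x :: real assume "x \<in> - {0}"
    then show "(inverse has_derivative (\<lambda>v. - (inverse x * v * inverse x))) (at x)"
      using has_derivative_inverse' by blast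
  next
    fix v :: real
    have "Ck_on k (- {0}) (\<lambda>x::real. (- v) * (inverse x * inverse x))"
      by (intro Ck_on_bilinear[OF o bounded_bilinear_mult] Ck_on_const Suc)
    then show "Ck_on k (- {0}) (\<lambda>x::real. - (inverse x * v * inverse x))"
      by (rule Ck_on_cong[OF o, rotated]) auto
  qed
qed (auto intro!: continuous_intros)

section \<open>Closure properties of smooth maps\<close>

lemma smooth_on_subset: "smooth_on S f \<Longrightarrow> T \<subseteq> S \<Longrightarrow> smooth_on T f"
  unfolding smooth_on_def using Ck_on_subset by blast

lemma smooth_on_cong: "open S \<Longrightarrow> (\<And>y. y \<in> S \<Longrightarrow> f y = g y) \<Longrightarrow> smooth_on S f \<Longrightarrow> smooth_on S g"
  unfolding smooth_on_def using Ck_on_cong by blast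

lemma smooth_on_const: "smooth_on S (\<lambda>x. c)"
  unfolding smooth_on_def using Ck_on_const by blast

lemma smooth_on_linear_compose: "open S \<Longrightarrow> bounded_linear L \<Longrightarrow> smooth_on S f \<Longrightarrow> smooth_on S (\<lambda>x. L (f x))"
  unfolding smooth_on_def using Ck_on_linear_compose by blast

lemma smooth_on_add: "open S \<Longrightarrow> smooth_on S f \<Longrightarrow> smooth_on S g \<Longrightarrow> smooth_on S (\<lambda>x. f x + g x)"
  unfolding smooth_on_def using Ck_on_add by blast

lemma smooth_on_mult:
  fixes f g :: "'a::euclidean_space \<Rightarrow> real"
  shows "open S \<Longrightarrow> smooth_on S f \<Longrightarrow> smooth_on S g \<Longrightarrow> smooth_on S (\<lambda>x. f x * g x)"
  unfolding smooth_on_def using Ck_on_bilinear[OF _ bounded_bilinear_mult] by blast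

lemma smooth_on_minus: "open S \<Longrightarrow> smooth_on S f \<Longrightarrow> smooth_on S (\<lambda>x. - f x)"
  using smooth_on_linear_compose[of S "\<lambda>x. - x"] by (simp add: bounded_linear_minus bounded_linear_ident)

lemma smooth_on_diff: "open S \<Longrightarrow> smooth_on S f \<Longrightarrow> smooth_on S g \<Longrightarrow> smooth_on S (\<lambda>x. f x - g x)"
  using smooth_on_add[of S f "\<lambda>x. - g x"] smooth_on_minus by auto

lemma smooth_on_compose:
  "open S \<Longrightarrow> open T \<Longrightarrow> smooth_on T g \<Longrightarrow> smooth_on S f \<Longrightarrow> (\<And>x. x \<in> S \<Longrightarrow> f x \<in> T) \<Longrightarrow> smooth_on S (\<lambda>x. g (f x))"
  unfolding smooth_on_def using Ck_on_compose[of S T f _ g] by blast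

lemma smooth_on_inverse:
  fixes f :: "'a::euclidean_space \<Rightarrow> real"
  shows "open S \<Longrightarrow> smooth_on S f \<Longrightarrow> (\<And>x. x \<in> S \<Longrightarrow> f x \<noteq> 0) \<Longrightarrow> smooth_on S (\<lambda>x. inverse (f x))"
  by (rule smooth_on_compose[of S "- {0}" inverse f]) (auto simp: smooth_on_def intro: Ck_on_inverse)

lemma smooth_on_divide:
  fixes f :: "'a::euclidean_space \<Rightarrow> real"
  shows "open S \<Longrightarrow> smooth_on S f \<Longrightarrow> smooth_on S g \<Longrightarrow> (\<And>x. x \<in> S \<Longrightarrow> g x \<noteq> 0) \<Longrightarrow> smooth_on S (\<lambda>x. f x / g x)"
  unfolding divide_inverse by (intro smooth_on_mult smooth_on_inverse)

lemma smooth_on_power: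
  fixes f :: "'a::euclidean_space \<Rightarrow> real"
  shows "open S \<Longrightarrow> smooth_on S f \<Longrightarrow> smooth_on S (\<lambda>x. f x ^ n)"
  by (induction n) (auto intro: smooth_on_const smooth_on_mult)

lemma smooth_on_ident: "open S \<Longrightarrow> smooth_on S (\<lambda>x. x)"
proof -
  assume o: "open S"
  have "Ck_on k S (\<lambda>x. x)" for k
  proof (cases k)
    case (Suc m)
    show ?thesis unfolding Suc
      by (rule Ck_on_SucI[OF o has_derivative_ident]) (rule Ck_on_const)
  qed auto
  then show ?thesis by (simp add: smooth_on_def)
qed

lemma smooth_on_fst: "open S \<Longrightarrow> smooth_on S f \<Longrightarrow> smooth_on S (\<lambda>x. fst (f x))"
  and smooth_on_snd: "open S \<Longrightarrow> smooth_on S f \<Longrightarrow> smooth_on S (\<lambda>x. snd (f x))"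
  by (rule smooth_on_linear_compose; simp add: bounded_linear_fst bounded_linear_snd)+

lemma smooth_on_Pair:
  assumes "open S" "smooth_on S f" "smooth_on S g"
  shows "smooth_on S (\<lambda>x. (f x, g x))"
proof -
  have "smooth_on S (\<lambda>x. (f x, 0) + (0, g x))"
    by (intro smooth_on_add smooth_on_linear_compose[of S "\<lambda>a. (a, 0)"] smooth_on_linear_compose[of S "\<lambda>a. (0, a)"]
        assms bounded_linear_Pair bounded_linear_ident bounded_linear_zero)
  then show ?thesis by simp
qed

lemmas smooth_on_intros = smooth_on_const smooth_on_add smooth_on_mult smooth_on_minus smooth_on_diff
  smooth_on_divide smooth_on_power smooth_on_ident smooth_on_fst smooth_on_snd smooth_on_Pair

lemma smooth_on_derivative:
  "smooth_on S f \<Longrightarrow> x \<in> S \<Longrightarrow> (f has_derivative frechet_derivative f (at x)) (at x)"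
  unfolding smooth_on_def using Ck_on_imp_derivative by blast

lemma smooth_on_frechet_derivative: "smooth_on S f \<Longrightarrow> smooth_on S (\<lambda>x. frechet_derivative f (at x) v)"
  unfolding smooth_on_def using Ck_on.simps(2) by blast

lemma smooth_on_imp_continuous_on: "smooth_on S f \<Longrightarrow> continuous_on S f"
  unfolding smooth_on_def using Ck_on.simps(1) by blast

lemma smooth_on_Un:
  assumes "open S" "open T" "smooth_on S f" "smooth_on T f"
  shows "smooth_on (S \<union> T) f"
proof -
  have "Ck_on k (S \<union> T) f" if "Ck_on k S f" "Ck_on k T f" for k
    using that by (induction k arbitrary: f) (auto intro: continuous_on_open_Un assms)
  then show ?thesis using assms unfolding smooth_on_def by blast
qed

text \<open>Directional derivatives stay in the span of the family, so one induction on the order,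
  run for all members at once, needs no formula for higher derivatives. The coefficients depend on
  the direction but not on the point.\<close>

lemma smooth_onI_family:
  assumes "open S"
    and "\<And>i x. x \<in> S \<Longrightarrow> (F i has_derivative F' i x) (at x)"
    and "\<And>i v. \<exists>j k a b. \<forall>x\<in>S. F' i x v = a * F j x + b * F k x"
  shows "smooth_on S (F i :: 'a::euclidean_space \<Rightarrow> real)"
proof -
  have c: "continuous_on S (F i)" for i
    using assms(2) by (meson continuous_at_imp_continuous_on has_derivative_continuous)
  have "Ck_on k S (F i)" for k i
  proof (induction k arbitrary: i)
    case (Suc k)
    show ?case
    proof (rule Ck_on_SucI[OF assms(1,2)])
      fix v
      obtain j l a b where e: "\<forall>x\<in>S. F' i x v = a * F j x + b * F l x" using assms(3) by blast
      have "Ck_on k S (\<lambda>x. a * F j x + b * F l x)"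
        by (intro Ck_on_add Ck_on_bilinear[OF assms(1) bounded_bilinear_mult] Ck_on_const Suc assms)
      then show "Ck_on k S (\<lambda>x. F' i x v)"
        by (rule Ck_on_cong[OF assms(1), rotated]) (use e in auto)
    qed
  qed (use c in auto)
  then show ?thesis by (simp add: smooth_on_def)
qed

section \<open>Smoothness of inverse functions\<close>

lemma smooth_on_inverse_map:
  fixes f g :: "'a::euclidean_space \<Rightarrow> 'a"
  assumes "open V" "homeomorphism U V f g" "open U" "smooth_on U f"
    and "\<And>y. y \<in> V \<Longrightarrow> (g has_derivative R (g y)) (at y)"
    and "\<And>v. smooth_on U (\<lambda>x. R x v)"
  shows "smooth_on V g"
proof -
  have c: "continuous_on V g" and gU: "g ` V \<subseteq> U" using assms(2) unfolding homeomorphism_def by auto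
  have "Ck_on k V g" for k
  proof (induction k)
    case (Suc k)
    \<comment> \<open>Bootstrapping: the derivative of \<open>g\<close> is \<open>R\<close> composed
      with \<open>g\<close>, hence as regular as \<open>g\<close> itself, which gains one
      order.\<close>
    show ?case
    proof (rule Ck_on_SucI[OF assms(1,5)])
      fix v
      show "Ck_on k V (\<lambda>y. R (g y) v)"
        by (rule Ck_on_compose[OF assms(1,3) gU Suc, of "\<lambda>x. R x v"]) (use assms(6) smooth_on_def in blast)
    qed
  qed (use c in auto)
  then show ?thesis by (simp add: smooth_on_def)
qed

text \<open>The inverse \<open>R\<close> of the derivative is supplied by the caller. All
  applications are to triangular maps, where \<open>R\<close> is an explicit quotient, so smoothness
  of operator inversion never enters.\<close>

lemma smooth_inverse_function:
  fixes f :: "'a::euclidean_space \<Rightarrow> 'a"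
  assumes "open S" "smooth_on S f" "x0 \<in> S"
    and L: "\<And>x. x \<in> S \<Longrightarrow> (f has_derivative L x) (at x)"
    and RL: "\<And>x v. x \<in> S \<Longrightarrow> R x (L x v) = v" and LR: "\<And>x v. x \<in> S \<Longrightarrow> L x (R x v) = v"
    and R: "\<And>v. smooth_on S (\<lambda>x. R x v)"
  obtains U V g where "U \<subseteq> S" "x0 \<in> U" "diffeomorphism U V f g"
proof -
  define f' where "f' x = Blinfun (L x)" for x
  have f': "blinfun_apply (f' x) = L x" if "x \<in> S" for x
    unfolding f'_def using L[OF that] by (simp add: bounded_linear_Blinfun_apply has_derivative_bounded_linear)
  have Rlin: "bounded_linear (R x)" if "x \<in> S" for x
  proof -
    have "linear (L x)" using L[OF that] has_derivative_linear by blast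
    then have "linear (R x)"
      using RL[OF that] LR[OF that] by (metis (no_types) linearI linear_add linear_cmul)
    then show ?thesis by (simp add: linear_conv_bounded_linear)
  qed
  \<comment> \<open>Continuity into the space of bounded operators is tested on basis vectors, where
    it is continuity of directional derivatives.\<close>
  have "continuous_on S f'"
  proof (rule continuous_on_blinfun_componentwise)
    fix i :: 'a
    have "continuous_on S (\<lambda>x. frechet_derivative f (at x) i)"
      using assms(2) smooth_on_frechet_derivative smooth_on_imp_continuous_on by blast
    moreover have "frechet_derivative f (at x) i = blinfun_apply (f' x) i" if "x \<in> S" for x
      using f'[OF that] L[OF that] by (metis frechet_derivative_at)
    ultimately show "continuous_on S (\<lambda>x. blinfun_apply (f' x) i)" by (rule continuous_on_eq)
  qed
  moreover have "Blinfun (R x0) o\<^sub>L f' x0 = id_blinfun"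
    using RL assms(3) f' by (intro blinfun_eqI) (simp add: bounded_linear_Blinfun_apply Rlin)
  ultimately obtain U V g g' where h: "open U" "U \<subseteq> S" "x0 \<in> U" "open V" "f x0 \<in> V" "homeomorphism U V f g"
    "\<And>y. y \<in> V \<Longrightarrow> (g has_derivative (g' y)) (at y)"
    "\<And>y. y \<in> V \<Longrightarrow> g' y = inv (blinfun_apply (f'(g y)))"
    using inverse_function_theorem[OF assms(1) _ _ assms(3), of f f' "Blinfun (R x0)"] L f' by metis
  have gS: "g y \<in> S" if "y \<in> V" for y using h(2,6) that unfolding homeomorphism_def by blast
  have "g' y = R (g y)" if "y \<in> V" for y
    unfolding h(8)[OF that] f'[OF gS[OF that]]
    using RL[OF gS[OF that]] LR[OF gS[OF that]] by (intro inv_equality) auto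
  then have "(g has_derivative R (g y)) (at y)" if "y \<in> V" for y using h(7) that by metis
  then have "smooth_on V g"
    using h(1,4,6) smooth_on_subset[OF R h(2)] smooth_on_subset[OF assms(2) h(2)]
    by (intro smooth_on_inverse_map[of V U f g R])
  then have "diffeomorphism U V f g"
    unfolding diffeomorphism_def using h assms(2) smooth_on_subset by blast
  then show ?thesis using that h by blast
qed

subsection \<open>Seeley extension\<close>

text \<open>
  The coefficients of Euler's product \<open>\<Prod>j. (1 - z / 4 ^ j)\<close>; they satisfy
  \<open>a\<^sub>k (4\<^sup>k - 1) = - 4 a\<^bsub>k-1\<^esub>\<close>. The product vanishes at every \<open>z = 4 ^ n\<close>, so all moments
  \<open>\<Sum>k. a\<^sub>k 4\<^bsup>kn\<^esup>\<close> are zero, and division by \<open>1 + 4\<^sup>k\<close> turns them into an alternating sequence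
  (up to the nonzero total mass), which is what a reflection across \<open>y = 0\<close> needs.
\<close>

primrec seeley_num :: "nat \<Rightarrow> real" where
  "seeley_num 0 = 1"
| "seeley_num (Suc k) = - 4 * seeley_num k / (4 ^ Suc k - 1)"

section \<open>Reflection coefficients and their moments\<close>

lemma four_power_gt_one: "(4::real) ^ Suc k > 1"
  by (rule one_less_power) auto

lemma divide_one_plus_power_le: "0 \<le> x \<Longrightarrow> x / (1 + 4 ^ k) \<le> (x::real)"
  by (rule mult_imp_div_pos_le) (auto simp: algebra_simps add_pos_pos)

text \<open>Consecutive terms have ratio 4 * 4^n / (4^(k+1) - 1), which tends to 0 for each fixed
  \<open>n\<close>; hence every moment converges absolutely.\<close>

lemma summable_seeley_num: "summable (\<lambda>k. \<bar>seeley_num k\<bar> * (4 ^ k) ^ n)"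
proof (rule summable_ratio_test[of "1/2" "n + 2"])
  fix k assume k: "n + 2 \<le> k"
  \<comment> \<open>From index \<open>n + 2\<close> on, the denominator is at least 64 * 4^n - 1,
    hence at least 8 * 4^n, and the ratio is at most 1/2.\<close>
  have "(4::real) ^ (n + 3) \<le> 4 ^ Suc k" using k by (intro power_increasing) auto
  then have "64 * 4 ^ n \<le> (4::real) ^ Suc k" by (simp add: power_add)
  moreover have "1 \<le> (4::real) ^ n" by simp
  ultimately have "8 * 4 ^ n \<le> (4::real) ^ Suc k - 1" by linarith
  moreover have p: "(4::real) ^ Suc k - 1 > 0" using four_power_gt_one[of k] by simp
  ultimately have "4 * 4 ^ n / ((4::real) ^ Suc k - 1) \<le> 1/2"
    by (simp add: divide_le_eq)
  then have "(4 * 4 ^ n / ((4::real) ^ Suc k - 1)) * (\<bar>seeley_num k\<bar> * (4 ^ k) ^ n) \<le> 1/2 * (\<bar>seeley_num k\<bar> * (4 ^ k) ^ n)"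
    by (intro mult_right_mono) auto
  moreover have "\<bar>seeley_num (Suc k)\<bar> * (4 ^ Suc k) ^ n = (4 * 4 ^ n / ((4::real) ^ Suc k - 1)) * (\<bar>seeley_num k\<bar> * (4 ^ k) ^ n)"
    using p by (simp add: abs_mult power_mult_distrib)
  moreover have e: "norm (\<bar>seeley_num k\<bar> * (4 ^ k) ^ n) = \<bar>seeley_num k\<bar> * (4 ^ k) ^ n" for k
    by (simp add: abs_mult)
  ultimately show "norm (\<bar>seeley_num (Suc k)\<bar> * (4 ^ Suc k) ^ n) \<le> 1/2 * norm (\<bar>seeley_num k\<bar> * (4 ^ k) ^ n)"
    unfolding e by linarith
qed auto

lemma seeley_num_Suc: "seeley_num (Suc k) * (4 ^ Suc k - 1) = - 4 * seeley_num k"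
  using four_power_gt_one[of k] by simp

text \<open>Multiplying the recurrence by 4^(kn) and summing gives m(n+1) = (1 - 4^(n+1)) m(n). The
  same relation one index lower, m(0) = (1 - 4^0) m(-1), starts the induction at zero.\<close>

lemma seeley_num_moment: "(\<lambda>k. seeley_num k * (4 ^ k) ^ n) sums 0"
proof -
  define m where "m n = (\<Sum>k. seeley_num k * (4 ^ k) ^ n)" for n
  have s: "summable (\<lambda>k. seeley_num k * (4 ^ k) ^ n)" for n
    using summable_seeley_num[of n] by - (rule summable_rabs_cancel, simp add: abs_mult)
  then have ms: "(\<lambda>k. seeley_num k * (4 ^ k) ^ n) sums m n" for n
    unfolding m_def by (rule summable_sums)
  \<comment> \<open>This is the moment of order -1; its convergence is needed for the start m(0) =
    0.\<close>
  have si: "summable (\<lambda>k. seeley_num k / 4 ^ k)"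
  proof (rule summable_comparison_test[OF _ summable_seeley_num[of 0]], intro exI allI impI)
    fix k :: nat
    have "\<bar>seeley_num k\<bar> * 1 \<le> \<bar>seeley_num k\<bar> * 4 ^ k"
      by (intro mult_left_mono one_le_power) auto
    then show "norm (seeley_num k / 4 ^ k) \<le> \<bar>seeley_num k\<bar> * (4 ^ k) ^ 0"
      by (simp add: divide_le_eq abs_divide)
  qed
  have m0: "m 0 = 0"
  proof -
    have "(\<lambda>k. seeley_num k * (4 ^ k) ^ 0 - seeley_num k / 4 ^ k) sums (m 0 - (\<Sum>k. seeley_num k / 4 ^ k))"
      by (intro sums_diff ms summable_sums si)
    moreover have "(\<lambda>k. seeley_num k * (4 ^ k) ^ 0 - seeley_num k / 4 ^ k) sums (- (\<Sum>k. seeley_num k / 4 ^ k) + 0)"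
    proof -
      have "(\<lambda>k. - (seeley_num k / 4 ^ k)) sums - (\<Sum>k. seeley_num k / 4 ^ k)"
        by (intro sums_minus summable_sums si)
      moreover have "seeley_num (Suc k) * (4 ^ Suc k) ^ 0 - seeley_num (Suc k) / 4 ^ Suc k = - (seeley_num k / 4 ^ k)" for k
      proof -
        have "seeley_num (Suc k) - seeley_num (Suc k) / 4 ^ Suc k = seeley_num (Suc k) * (4 ^ Suc k - 1) / 4 ^ Suc k"
          by (simp add: diff_divide_distrib right_diff_distrib del: seeley_num.simps power_Suc)
        then show ?thesis unfolding seeley_num_Suc by simp
      qed
      \<comment> \<open>The recurrence expresses terms with index \<open>Suc k\<close>; the series
        is shifted, and its term at index 0 is zero, whence the summand \<open>0\<close>.\<close>
      ultimately show ?thesis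
        using sums_Suc_iff[of "\<lambda>k. seeley_num k * (4 ^ k) ^ 0 - seeley_num k / 4 ^ k"] by (simp del: seeley_num.simps(2))
    qed
    ultimately show ?thesis using sums_unique2 by fastforce
  qed
  have step: "m (Suc n) = (1 - 4 ^ Suc n) * m n" for n
  proof -
    have "(\<lambda>k. seeley_num k * (4 ^ k) ^ Suc n - seeley_num k * (4 ^ k) ^ n) sums (m (Suc n) - m n)"
      by (intro sums_diff ms)
    moreover have "(\<lambda>k. seeley_num k * (4 ^ k) ^ Suc n - seeley_num k * (4 ^ k) ^ n) sums (- (4 ^ Suc n) * m n + 0)"
    proof -
      have "(\<lambda>k. - (4 ^ Suc n) * (seeley_num k * (4 ^ k) ^ n)) sums (- (4 ^ Suc n) * m n)"
        by (intro sums_mult ms)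
      moreover have "seeley_num (Suc k) * (4 ^ Suc k) ^ Suc n - seeley_num (Suc k) * (4 ^ Suc k) ^ n
          = - (4 ^ Suc n) * (seeley_num k * (4 ^ k) ^ n)" for k
      proof -
        have "seeley_num (Suc k) * (4 ^ Suc k) ^ Suc n - seeley_num (Suc k) * (4 ^ Suc k) ^ n
          = (seeley_num (Suc k) * (4 ^ Suc k - 1)) * (4 ^ Suc k) ^ n"
          by (simp add: algebra_simps del: seeley_num.simps)
        also have "\<dots> = - 4 * seeley_num k * (4 * 4 ^ k) ^ n" unfolding seeley_num_Suc by simp
        finally show ?thesis by (simp add: power_mult_distrib del: seeley_num.simps)
      qed
      ultimately show ?thesis
        using sums_Suc_iff[of "\<lambda>k. seeley_num k * (4 ^ k) ^ Suc n - seeley_num k * (4 ^ k) ^ n"] by (simp del: seeley_num.simps(2))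
    qed
    ultimately have "m (Suc n) - m n = - (4 ^ Suc n) * m n + 0" by (rule sums_unique2)
    then show ?thesis by (simp add: algebra_simps)
  qed
  have "m n = 0" by (induction n) (simp_all add: m0 step)
  then show ?thesis using ms by metis
qed

text \<open>The signs alternate and the moduli \<open>u\<close> decrease to 0, so the Leibniz bound
  places the sum above the partial sum of its first two terms, 1/2 - 4/15.\<close>

lemma seeley_total_nonzero: "(\<Sum>k. seeley_num k / (1 + 4 ^ k)) > 0"
proof -
  define u where "u k = \<bar>seeley_num k\<bar> / (1 + 4 ^ k)" for k
  have sgn: "seeley_num k = (-1) ^ k * \<bar>seeley_num k\<bar>" for k
  proof (induction k)
    case (Suc k)
    have p: "(4::real) ^ Suc k - 1 > 0" using four_power_gt_one[of k] by simp
    then have "\<bar>seeley_num (Suc k)\<bar> = 4 * \<bar>seeley_num k\<bar> / (4 ^ Suc k - 1)" by (simp add: abs_mult)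
    then show ?case using Suc p by (simp add: divide_simps)
  qed simp
  have le: "u k \<le> \<bar>seeley_num k\<bar> * (4 ^ k) ^ 0" for k
    unfolding u_def by (simp add: divide_one_plus_power_le)
  have "summable u"
    by (rule summable_comparison_test[OF _ summable_seeley_num[of 0]]) (use le in \<open>auto simp: u_def\<close>)
  then have lim: "u \<longlonglongrightarrow> 0" by (rule summable_LIMSEQ_zero)
  have "u (Suc k) \<le> u k" for k
  proof -
    have p: "(4::real) ^ Suc k - 1 > 0" using four_power_gt_one[of k] by simp
    define X where "X = (4::real) ^ k"
    have X: "X \<ge> 1" unfolding X_def by (rule one_le_power) simp
    \<comment> \<open>With \<open>X = 4 ^ k\<close> this is the decrease of \<open>u\<close> cleared
      of denominators; the right-hand side equals 16 X^2 - 1.\<close>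
    have "4 * (1 + X) \<le> (4 * X - 1) * (1 + 4 * X)"
    proof -
      have "X \<le> X * X" using X by (simp add: mult_le_cancel_left1)
      then have "5 + X * 4 \<le> 16 * (X * X)" using X by linarith
      then show ?thesis by (simp add: algebra_simps)
    qed
    then have q: "4 / ((4 * X - 1) * (1 + 4 * X)) \<le> 1 / (1 + X)"
      using X by (simp add: divide_simps mult.commute)
    have "u (Suc k) = \<bar>seeley_num k\<bar> * (4 / ((4 * X - 1) * (1 + 4 * X)))"
      unfolding u_def using p by (simp add: abs_mult X_def)
    also have "\<dots> \<le> \<bar>seeley_num k\<bar> * (1 / (1 + X))" using q by (intro mult_left_mono) auto
    finally show ?thesis by (simp add: u_def X_def)
  qed
  then have "monoseq u" by (intro decseq_imp_monoseq decseq_SucI)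
  moreover have "0 < u 0" by (simp add: u_def)
  \<comment> \<open>The bound \<open>2*1\<close> matches the form \<open>2*n\<close> of the even
    partial sums in the Leibniz criterion.\<close>
  ultimately have "(\<Sum>i<2*1. (-1) ^ i * u i) \<le> (\<Sum>i. (-1) ^ i * u i)"
    using summable_Leibniz(2)[OF lim] by (meson atLeastAtMost_iff)
  moreover have "(\<Sum>i<2*1. (-1) ^ i * u i) > 0" by (simp add: u_def numeral_2_eq_2)
  moreover have "(-1) ^ i * u i = seeley_num i / (1 + 4 ^ i)" for i using sgn[of i] by (simp add: u_def)
  ultimately show ?thesis by simp
qed

lemma seeley_coefficients:
  obtains c :: "nat \<Rightarrow> real"
  where "\<And>n. summable (\<lambda>k. \<bar>c k\<bar> * (4 ^ k) ^ n)" "\<And>n. (\<lambda>k. c k * (- (4 ^ k)) ^ n) sums 1"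
proof -
  define d where "d k = seeley_num k / (1 + 4 ^ k)" for k
  have le: "\<bar>d k\<bar> * (4 ^ k) ^ n \<le> \<bar>seeley_num k\<bar> * (4 ^ k) ^ n" for k n
    unfolding d_def by (intro mult_right_mono) (use divide_one_plus_power_le[of "\<bar>seeley_num k\<bar>" k] in \<open>auto simp: abs_divide\<close>)
  have d1: "summable (\<lambda>k. \<bar>d k\<bar> * (4 ^ k) ^ n)" for n
    by (rule summable_comparison_test[OF _ summable_seeley_num[of n]]) (use le in \<open>auto simp: abs_mult\<close>)
  then have s: "summable (\<lambda>k. d k * (4 ^ k) ^ n)" for n
    by - (rule summable_rabs_cancel, simp add: abs_mult)
  define t where "t n = (\<Sum>k. d k * (4 ^ k) ^ n)" for n
  have ts: "(\<lambda>k. d k * (4 ^ k) ^ n) sums t n" for n using s unfolding t_def by (rule summable_sums)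
  \<comment> \<open>The factor \<open>1 + 4 ^ k\<close> restores \<open>seeley_num k\<close>, so two
    consecutive moments of \<open>d\<close> add up to a vanishing one.\<close>
  have "t (Suc n) = - t n" for n
  proof -
    have "(\<lambda>k. d k * (4 ^ k) ^ Suc n + d k * (4 ^ k) ^ n) sums (t (Suc n) + t n)"
      by (intro sums_add ts)
    moreover have "d k * (4 ^ k) ^ Suc n + d k * (4 ^ k) ^ n = seeley_num k * (4 ^ k) ^ n" for k
    proof -
      have "(1 + 4 ^ k :: real) \<noteq> 0" using zero_less_power[of "4::real" k] by linarith
      moreover have "d k * (4 ^ k) ^ Suc n + d k * (4 ^ k) ^ n = (d k * (1 + 4 ^ k)) * (4 ^ k) ^ n" by (simp add: algebra_simps)
      ultimately show ?thesis by (simp add: d_def)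
    qed
    ultimately show ?thesis using seeley_num_moment[of n] sums_unique2 by fastforce
  qed
  then have tn: "t n = (-1) ^ n * t 0" for n by (induction n) auto
  have t0: "t 0 \<noteq> 0" using seeley_total_nonzero by (simp add: t_def d_def)
  show ?thesis
  proof (rule that[of "\<lambda>k. d k / t 0"])
    fix n
    show "summable (\<lambda>k. \<bar>d k / t 0\<bar> * (4 ^ k) ^ n)"
      using summable_divide[OF d1[of n], of "\<bar>t 0\<bar>"] by (simp add: abs_divide)
    have "(\<lambda>k. (-1) ^ n * (d k * (4 ^ k) ^ n) / t 0) sums ((-1) ^ n * t n / t 0)"
      by (intro sums_divide sums_mult ts)
    moreover have "(-1) ^ n * t n / t 0 = 1" using t0 tn[of n] by (simp add: power_mult_distrib[symmetric])
    moreover have "(-1) ^ n * (d k * (4 ^ k) ^ n) / t 0 = d k / t 0 * (- (4 ^ k)) ^ n" for k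
      by (simp add: power_minus[of "4 ^ k"])
    ultimately show "(\<lambda>k. d k / t 0 * (- (4 ^ k)) ^ n) sums 1" by simp
  qed
qed

text \<open>By the mean value theorem each difference quotient at \<open>a\<close> is a value of
  \<open>f'\<close> at a point between, and these values tend to \<open>f' a\<close>.\<close>

lemma DERIV_continuous_extension:
  fixes f f' :: "real \<Rightarrow> real"
  assumes "continuous_on UNIV f" "isCont f' a"
    and d: "\<And>x. x \<noteq> a \<Longrightarrow> (f has_real_derivative f' x) (at x)"
  shows "(f has_real_derivative f' a) (at a)"
  unfolding has_field_derivative_iff LIM_eq
proof (intro allI impI)
  fix e :: real assume "e > 0"
  then obtain s where s: "s > 0" "\<And>x. \<bar>x - a\<bar> < s \<Longrightarrow> \<bar>f' x - f' a\<bar> < e"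
    using assms(2) unfolding continuous_at_eps_delta dist_real_def by blast
  have cont: "continuous_on X f" for X using assms(1) continuous_on_subset by blast
  have "norm ((f x - f a) / (x - a) - f' a) < e" if x: "x \<noteq> a" "norm (x - a) < s" for x
  proof -
    have "\<exists>z. \<bar>z - a\<bar> < s \<and> (f x - f a) / (x - a) = f' z"
    proof (cases "a < x")
      case True
      obtain l z where z: "a < z" "z < x" "DERIV f z :> l" "f x - f a = (x - a) * l"
        using MVT[OF True cont] d real_differentiable_def by (metis less_irrefl)
      then have "l = f' z" using d[of z] DERIV_unique by blast
      then show ?thesis using z x True by (intro exI[of _ z]) auto
    next
      case False
      then have lt: "x < a" using x by simp
      obtain l z where z: "x < z" "z < a" "DERIV f z :> l" "f a - f x = (a - x) * l"
        using MVT[OF lt cont] d real_differentiable_def by (metis less_irrefl)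
      then have "l = f' z" using d[of z] DERIV_unique by blast
      moreover have "f x - f a = (x - a) * l" using z(4) by (simp add: algebra_simps)
      ultimately show ?thesis using z x lt by (intro exI[of _ z]) auto
    qed
    then show ?thesis using s(2) by auto
  qed
  then show "\<exists>s>0. \<forall>x. x \<noteq> a \<and> norm (x - a) < s \<longrightarrow> norm ((f x - f a) / (x - a) - f' a) < e"
    using s(1) by blast
qed

text \<open>An increment splits into a move in the first variable at height \<open>y\<close>,
  governed by \<open>f1\<close>, and a move in the second, governed by the continuous
  \<open>f2\<close>.\<close>

lemma has_derivative_continuous_partials:
  fixes f f2 :: "real \<times> real \<Rightarrow> real"
  assumes "((\<lambda>a. f (a, y)) has_real_derivative f1) (at x)"
    and "\<And>a b. ((\<lambda>b. f (a, b)) has_real_derivative f2 (a, b)) (at b)"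
    and "continuous_on UNIV f2"
  shows "(f has_derivative (\<lambda>v. fst v * f1 + snd v * f2 (x, y))) (at (x, y))"
proof -
  have "((\<lambda>(a, b). f (a, b)) has_derivative (\<lambda>(tx, ty). f1 * tx + blinfun_mult_right (f2 (x, y)) ty)) (at (x, y) within UNIV \<times> UNIV)"
  proof (rule has_derivative_partialsI)
    show "((\<lambda>a. f (a, y)) has_derivative (*) f1) (at x within UNIV)"
      using assms(1) by (simp add: has_field_derivative_def)
    show "((\<lambda>b. f (a, b)) has_derivative blinfun_apply (blinfun_mult_right (f2 (a, b)))) (at b within UNIV)" for a b
      using assms(2)[of a b] by (simp add: has_field_derivative_def)
    have "continuous_on UNIV (\<lambda>p. blinfun_mult_right (f2 p))"
      using assms(3) by (intro continuous_intros)
    then have "isCont (\<lambda>p. blinfun_mult_right (f2 p)) (x, y)"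
      by (simp only: continuous_on_eq_continuous_at open_UNIV UNIV_I)
    then show "continuous (at (x, y) within UNIV \<times> UNIV) (\<lambda>(a, b). blinfun_mult_right (f2 (a, b)))"
      by (simp add: split_beta')
  qed auto
  moreover have "(\<lambda>(tx, ty). f1 * tx + blinfun_mult_right (f2 (x, y)) ty) = (\<lambda>v. fst v * f1 + snd v * f2 (x, y))"
    by (auto simp: fun_eq_iff)
  ultimately show ?thesis by simp
qed

text \<open>\<open>A i m\<close> plays the role of \<open>\<partial>\<^sub>x\<^sup>i \<partial>\<^sub>y\<^sup>m (A 0 0)\<close> on the closed upper half plane.\<close>

lemma seeley_extension:
  fixes A :: "nat \<Rightarrow> nat \<Rightarrow> real \<times> real \<Rightarrow> real"
  assumes cont: "\<And>i m. continuous_on (UNIV \<times> {0..}) (A i m)"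
    and bdd: "\<And>i m. \<exists>M. \<forall>x y. y \<ge> 0 \<longrightarrow> \<bar>A i m (x, y)\<bar> \<le> M"
    and dx: "\<And>i m x y. y \<ge> 0 \<Longrightarrow> ((\<lambda>a. A i m (a, y)) has_real_derivative A (Suc i) m (x, y)) (at x)"
    and dy: "\<And>i m x y. y > 0 \<Longrightarrow> ((\<lambda>b. A i m (x, b)) has_real_derivative A i (Suc m) (x, y)) (at y)"
  obtains E where "smooth_on UNIV E" "\<And>x y. y \<ge> 0 \<Longrightarrow> E (x, y) = A 0 0 (x, y)"
proof -
  obtain c :: "nat \<Rightarrow> real" where cs: "\<And>n. summable (\<lambda>k. \<bar>c k\<bar> * (4 ^ k) ^ n)"
    and c1: "\<And>n. (\<lambda>k. c k * (- (4 ^ k)) ^ n) sums 1"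
    using seeley_coefficients by blast
  \<comment> \<open>\<open>S i m\<close> is the \<open>m\<close>-th formal \<open>y\<close>-derivative of the reflected function \<open>\<Sum>k. c k * A i 0 (x, - 4 ^ k * y)\<close>;
    the moments of \<open>c\<close> make it agree with \<open>A i m\<close> at \<open>y = 0\<close>.\<close>
  define T where "T i m k p = c k * (- (4 ^ k)) ^ m * A i m (fst p, 4 ^ k * \<bar>snd p\<bar>)" for i m k p
  define S where "S i m p = (\<Sum>k. T i m k p)" for i m p
  have bdT: "\<exists>M. summable M \<and> (\<forall>k p. norm (T i m k p) \<le> M k)" for i m
  proof -
    obtain B where B: "\<And>x y. y \<ge> 0 \<Longrightarrow> \<bar>A i m (x, y)\<bar> \<le> B" using bdd by blast
    have "norm (T i m k p) \<le> \<bar>c k\<bar> * (4 ^ k) ^ m * B" for k p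
    proof -
      have "\<bar>A i m (fst p, 4 ^ k * \<bar>snd p\<bar>)\<bar> \<le> B" by (rule B) simp
      then show ?thesis by (simp add: T_def abs_mult power_abs mult_left_mono)
    qed
    then show ?thesis using summable_mult2[OF cs[of m], of B] by blast
  qed
  have contT: "continuous_on UNIV (T i m k)" for i m k
    unfolding T_def
    by (intro continuous_intros continuous_on_compose2[OF cont]) auto
  have contS: "continuous_on UNIV (S i m)" for i m
  proof -
    obtain M where M: "summable M" "\<And>k p. norm (T i m k p) \<le> M k" using bdT by blast
    have "uniform_limit UNIV (\<lambda>n p. \<Sum>k<n. T i m k p) (S i m) sequentially"
      unfolding S_def by (rule Weierstrass_m_test[OF _ M(1)]) (use M(2) in auto)
    then show ?thesis
      by (rule uniform_limit_theorem[rotated]) (auto intro!: always_eventually continuous_on_sum contT)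
  qed
  have T_sum: "summable (\<lambda>k. T i m k p)" for i m p
  proof -
    obtain M where "summable M" "\<And>k p. norm (T i m k p) \<le> M k" using bdT by blast
    then show ?thesis by (rule summable_comparison_test'[where N=0])
  qed
  have unif: "uniformly_convergent_on X (\<lambda>n x. \<Sum>k<n. T i m k (h x))" for i m X and h :: "real \<Rightarrow> real \<times> real"
  proof -
    obtain M where M: "summable M" "\<And>k p. norm (T i m k p) \<le> M k" using bdT by blast
    show ?thesis by (rule Weierstrass_m_test'[OF _ M(1)]) (use M(2) in auto)
  qed
  have S0: "S i m (x, 0) = A i m (x, 0)" for i m x
    using sums_mult2[OF c1[of m], of "A i m (x, 0)"] unfolding S_def T_def by (simp add: sums_iff)
  have Sx: "((\<lambda>a. S i m (a, y)) has_real_derivative S (Suc i) m (x, y)) (at x)" for i m x y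
    unfolding S_def
  proof (rule has_field_derivative_series'(2)[of UNIV _ _ 0])
    show "((\<lambda>a. T i m k (a, y)) has_real_derivative T (Suc i) m k (a, y)) (at a within UNIV)" for k a
      unfolding T_def by (auto intro!: derivative_eq_intros dx)
  qed (use unif[of UNIV _ _ "\<lambda>a. (a, y)"] T_sum in auto)
  have Sy: "((\<lambda>b. S i m (x, b)) has_real_derivative S i (Suc m) (x, y)) (at y)" if "y < 0" for i m x y
    unfolding S_def
  proof (rule has_field_derivative_series'(2)[of "{..<0}" _ _ y])
    show "((\<lambda>b. T i m k (x, b)) has_real_derivative T i (Suc m) k (x, b)) (at b within {..<0})" if "b \<in> {..<0}" for k b
    proof -
      have b: "b < 0" using that by simp
      have "((\<lambda>b. A i m (x, 4 ^ k * (- b))) has_real_derivative A i (Suc m) (x, 4 ^ k * (- b)) * (- (4 ^ k))) (at b)"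
        by (rule DERIV_chain2[OF dy]) (use b in \<open>auto intro!: derivative_eq_intros mult_pos_neg\<close>)
      then have "((\<lambda>b. c k * (- (4 ^ k)) ^ m * A i m (x, 4 ^ k * (- b))) has_real_derivative T i (Suc m) k (x, b)) (at b)"
        using b by (auto intro!: derivative_eq_intros simp: T_def)
      then have "((\<lambda>b. T i m k (x, b)) has_real_derivative T i (Suc m) k (x, b)) (at b)"
        by (rule has_field_derivative_transform_within_open[where S="{..<0}"]) (use b in \<open>auto simp: T_def\<close>)
      then show ?thesis by (rule has_field_derivative_at_within)
    qed
  qed (use that unif[of "{..<0}" _ _ "\<lambda>b. (x, b)"] T_sum in \<open>auto simp: interior_open\<close>)
  define E where "E i m p = (if snd p \<ge> 0 then A i m p else S i m p)" for i m p
  have E_eq: "E i m p = A i m (fst p, max (snd p) 0) + S i m (fst p, min (snd p) 0) - A i m (fst p, 0)" for i m p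
    by (cases p) (auto simp: E_def S0 max_def min_def)
  have contE: "continuous_on UNIV (E i m)" for i m
    unfolding E_eq[abs_def]
    by (intro continuous_intros continuous_on_compose2[OF cont] continuous_on_compose2[OF contS]) auto
  have Ex: "((\<lambda>a. E i m (a, y)) has_real_derivative E (Suc i) m (x, y)) (at x)" for i m x y
    using dx[of y i m x] Sx[of i m y x] by (cases "y \<ge> 0") (auto simp: E_def)
  have Ey: "((\<lambda>b. E i m (x, b)) has_real_derivative E i (Suc m) (x, y)) (at y)" for i m x y
  proof -
    have pos: "((\<lambda>b. E i m (x, b)) has_real_derivative E i (Suc m) (x, y)) (at y)" if y: "y \<noteq> 0" for y
    proof (cases "y > 0")
      case True
      have "((\<lambda>b. E i m (x, b)) has_real_derivative A i (Suc m) (x, y)) (at y)"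
        by (rule has_field_derivative_transform_within_open[OF dy[OF True], where S="{0<..}"]) (use True in \<open>auto simp: E_def\<close>)
      then show ?thesis using True by (simp add: E_def)
    next
      case False
      then have n: "y < 0" using y by simp
      have "((\<lambda>b. E i m (x, b)) has_real_derivative S i (Suc m) (x, y)) (at y)"
        by (rule has_field_derivative_transform_within_open[OF Sy[OF n], where S="{..<0}"]) (use n in \<open>auto simp: E_def\<close>)
      then show ?thesis using n by (simp add: E_def)
    qed
    have l: "continuous_on UNIV (\<lambda>b. E i m (x, b))" for m
      by (intro continuous_on_compose2[OF contE] continuous_intros) auto
    show ?thesis
    proof (cases "y = 0")
      \<comment> \<open>On the boundary line the derivative comes from its continuous extension,
        since the formula holds on both sides.\<close>
      case True
      show ?thesis unfolding True
        by (rule DERIV_continuous_extension[where f' = "\<lambda>b. E i (Suc m) (x, b)"])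
           (use l pos in \<open>auto simp: continuous_on_eq_continuous_at\<close>)
    qed (use pos in simp)
  qed
  \<comment> \<open>Pairs serve as the single index over which \<open>smooth_onI_family\<close>
    runs.\<close>
  define F where "F = (\<lambda>(i, m). E i m)"
  have "smooth_on UNIV (F (0, 0))"
  proof (rule smooth_onI_family[where F' = "\<lambda>(i, m) p v. fst v * E (Suc i) m p + snd v * E i (Suc m) p"])
    show "(F j has_derivative (case j of (i, m) \<Rightarrow> \<lambda>p v. fst v * E (Suc i) m p + snd v * E i (Suc m) p) p) (at p)" for j p
      using has_derivative_continuous_partials[OF Ex Ey contE] by (cases j; cases p) (simp add: F_def)
    show "\<exists>j' k' a b. \<forall>p\<in>UNIV. (case j of (i, m) \<Rightarrow> \<lambda>p v. fst v * E (Suc i) m p + snd v * E i (Suc m) p) p v = a * F j' p + b * F k' p" for j v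
      by (cases j, rule exI[of _ "(Suc (fst j), snd j)"], rule exI[of _ "(fst j, Suc (snd j))"]) (auto simp: F_def)
  qed auto
  then show ?thesis by (intro that[of "E 0 0"]) (auto simp: F_def E_def)
qed

subsection \<open>Cutoff functions\<close>

lemma smooth_on_deriv:
  fixes f :: "real \<Rightarrow> real"
  assumes "smooth_on S f" "x \<in> S"
  shows "(f has_real_derivative deriv f x) (at x)"
proof -
  have "f differentiable (at x)" using smooth_on_derivative[OF assms] differentiable_def by blast
  then show ?thesis using DERIV_deriv_iff_real_differentiable by blast
qed

lemma smooth_on_deriv_smooth:
  fixes f :: "real \<Rightarrow> real"
  assumes "open S" "smooth_on S f"
  shows "smooth_on S (deriv f)"
proof (rule smooth_on_cong[OF assms(1) _ smooth_on_frechet_derivative[OF assms(2), of 1]])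
  fix y assume "y \<in> S"
  then have "(f has_derivative (*) (deriv f y)) (at y)"
    using smooth_on_deriv[OF assms(2)] by (simp add: has_field_derivative_def)
  then show "frechet_derivative f (at y) 1 = deriv f y"
    by (metis frechet_derivative_at mult.right_neutral)
qed

lemma smooth_on_deriv_funpow:
  fixes f :: "real \<Rightarrow> real"
  assumes "open S" "smooth_on S f"
  shows "smooth_on S ((deriv ^^ n) f)"
  by (induction n) (auto intro: assms smooth_on_deriv_smooth)

lemma deriv_funpow_cong_open:
  fixes f g :: "real \<Rightarrow> real"
  assumes "open S" "\<And>x. x \<in> S \<Longrightarrow> f x = g x"
  shows "x \<in> S \<Longrightarrow> (deriv ^^ n) f x = (deriv ^^ n) g x"
proof (induction n arbitrary: x)
  case (Suc n)
  have "\<forall>\<^sub>F y in nhds x. (deriv ^^ n) f y = (deriv ^^ n) g y"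
    using eventually_nhds_in_open[OF assms(1) Suc.prems] by eventually_elim (rule Suc.IH)
  then show ?case by (simp add: deriv_cong_ev)
qed (use assms in auto)

section \<open>Flat functions and plateaus\<close>

lemma poly_div_exp_at_top: "((\<lambda>y::real. y ^ k * poly p y / exp y) \<longlongrightarrow> 0) at_top"
proof (induction p arbitrary: k)
  case (pCons a p)
  \<comment> \<open>The factor \<open>y ^ k\<close>, general in the induction, absorbs the shift of
    degree in \<open>pCons\<close>.\<close>
  have "((\<lambda>y. a * (y ^ k / exp y) + y ^ Suc k * poly p y / exp y) \<longlongrightarrow> a * 0 + 0) at_top"
    by (intro tendsto_intros tendsto_power_div_exp_0 pCons)
  then show ?case by (simp add: algebra_simps add_divide_distrib)
qed simp

text \<open>This is p(1/x) exp(-1/x), continued by zero. The polynomial parameter makes the family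
  closed under differentiation.\<close>

definition flat :: "real poly \<Rightarrow> real \<Rightarrow> real" where
  "flat p x = (if x > 0 then poly p (inverse x) / exp (inverse x) else 0)"

lemma continuous_flat: "continuous_on UNIV (flat p)"
proof -
  have "isCont (flat p) x" for x
  proof (cases x "0::real" rule: linorder_cases)
    case less
    have "isCont (\<lambda>x. 0::real) x" by simp
    then show ?thesis
      by (rule isCont_cong[THEN iffD1, rotated])
         (use eventually_nhds_in_open[of "{..<0}" x] less in \<open>auto simp: flat_def elim!: eventually_mono\<close>)
  next
    case greater
    have "isCont (\<lambda>x. poly p (inverse x) / exp (inverse x)) x"
      using greater by (intro continuous_intros) auto
    then show ?thesis
      by (rule isCont_cong[THEN iffD1, rotated])
         (use eventually_nhds_in_open[of "{0<..}" x] greater in \<open>auto simp: flat_def elim!: eventually_mono\<close>)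
  next
    case equal
    have "((\<lambda>x. poly p (inverse x) / exp (inverse x)) \<longlongrightarrow> 0) (at_right 0)"
      using filterlim_compose[OF poly_div_exp_at_top[of 0 p] filterlim_inverse_at_top_right] by simp
    then have r: "(flat p \<longlongrightarrow> 0) (at_right 0)"
      by (rule Lim_transform_eventually) (auto simp: eventually_at_filter flat_def)
    have "(flat p \<longlongrightarrow> 0) (at_left 0)"
      by (rule tendsto_eventually) (auto simp: eventually_at_filter flat_def)
    then have "(flat p \<longlongrightarrow> 0) (at 0)" using r by (rule filterlim_split_at)
    then show ?thesis unfolding equal isCont_def by (simp add: flat_def)
  qed
  then show ?thesis by (simp add: continuous_at_imp_continuous_on)
qed

text \<open>With y = 1/x, the derivative of p(y) exp(-y) is y^2 (p - p')(y) exp(-y); the factor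
  \<open>[:0, 0, 1:]\<close> is y^2. At 0 the derivative extends continuously.\<close>

lemma DERIV_flat: "(flat p has_real_derivative flat ([:0, 0, 1:] * (p - pderiv p)) x) (at x)"
proof -
  let ?q = "[:0, 0, 1:] * (p - pderiv p)"
  have pos: "(flat p has_real_derivative flat ?q x) (at x)" if "x \<noteq> 0" for x
  proof (cases "x > 0")
    case True
    have "((\<lambda>x. poly p (inverse x) / exp (inverse x)) has_real_derivative flat ?q x) (at x)"
      using True by (auto intro!: derivative_eq_intros simp: flat_def divide_simps) (simp add: algebra_simps power2_eq_square)
    then show ?thesis
      by (rule has_field_derivative_transform_within_open[where S="{0<..}"]) (use True in \<open>auto simp: flat_def\<close>)
  next
    case False
    have "((\<lambda>x. 0) has_real_derivative 0) (at x)" by simp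
    then have "(flat p has_real_derivative 0) (at x)"
      by (rule has_field_derivative_transform_within_open[where S="{..<0}"]) (use False that in \<open>auto simp: flat_def\<close>)
    then show ?thesis using False by (simp add: flat_def)
  qed
  show ?thesis
  proof (cases "x = 0")
    case True
    show ?thesis unfolding True
      by (rule DERIV_continuous_extension[OF continuous_flat _ pos])
         (use continuous_flat in \<open>auto simp: continuous_on_eq_continuous_at\<close>)
  qed (rule pos)
qed

lemma smooth_on_flat: "smooth_on UNIV (flat p)"
proof -
  define d where "d p = [:0, 0, 1:] * (p - pderiv p)" for p :: "real poly"
  show ?thesis
  proof (rule smooth_onI_family[where F' = "\<lambda>p x v. v * flat (d p) x"])
    show "(flat p has_derivative (\<lambda>v. v * flat (d p) x)) (at x)" for p x
      using DERIV_flat[of p x] unfolding d_def[symmetric] by (simp add: has_field_derivative_def mult_commute_abs)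
    show "\<exists>j k a b. \<forall>x\<in>UNIV. v * flat (d p) x = a * flat j x + b * flat k x" for p v
      by (rule exI[of _ "d p"], rule exI[of _ "d p"], rule exI[of _ v], rule exI[of _ 0]) simp
  qed simp
qed

lemma smooth_plateau:
  fixes t0 r :: real
  assumes "r > 0"
  obtains \<eta> where "smooth_on UNIV \<eta>" "\<And>x. \<bar>x - t0\<bar> \<le> r \<Longrightarrow> \<eta> x = (1::real)" "\<And>x. \<bar>x - t0\<bar> \<ge> 3/2 * r \<Longrightarrow> \<eta> x = 0"
proof -
  \<comment> \<open>The square avoids the corner of the modulus. The plateau corresponds to y at
    most 1 and the zero set to y at least 2, and (3/2)^2 exceeds 2.\<close>
  define y where "y x = ((x - t0) / r)\<^sup>2" for x
  define h where "h = flat 1"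
  have h: "smooth_on UNIV h" unfolding h_def by (rule smooth_on_flat)
  have hp: "h x > 0" if "x > 0" for x using that by (simp add: h_def flat_def)
  have h0: "h x = 0" if "x \<le> 0" for x using that by (simp add: h_def flat_def)
  have hn: "h x \<ge> 0" for x using hp[of x] h0[of x] by (cases "x > 0") auto
  have ys: "smooth_on UNIV y" unfolding y_def using assms by (intro smooth_on_intros) auto
  \<comment> \<open>The numbers 2 - y and y - 1 add up to 1, so one of them is positive.\<close>
  have den: "h (2 - y x) + h (y x - 1) \<noteq> 0" for x
    using hp[of "2 - y x"] hp[of "y x - 1"] hn[of "2 - y x"] hn[of "y x - 1"] by (cases "y x < 2") fastforce+
  show ?thesis
  proof (rule that[of "\<lambda>x. h (2 - y x) / (h (2 - y x) + h (y x - 1))"])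
    show "smooth_on UNIV (\<lambda>x. h (2 - y x) / (h (2 - y x) + h (y x - 1)))"
      using den by (intro smooth_on_intros smooth_on_compose[OF _ _ h] ys) auto
    fix x
    show "h (2 - y x) / (h (2 - y x) + h (y x - 1)) = 1" if "\<bar>x - t0\<bar> \<le> r"
    proof -
      have "y x \<le> 1" using that assms unfolding y_def by (simp add: abs_square_le_1)
      then have "h (y x - 1) = 0" using h0 by simp
      then show ?thesis using den[of x] by simp
    qed
    show "h (2 - y x) / (h (2 - y x) + h (y x - 1)) = 0" if "\<bar>x - t0\<bar> \<ge> 3/2 * r"
    proof -
      have "3/2 \<le> \<bar>(x - t0) / r\<bar>" using that assms by (simp add: abs_divide pos_le_divide_eq)
      then have "(3/2)\<^sup>2 \<le> \<bar>(x - t0) / r\<bar>\<^sup>2" by (rule power_mono) simp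
      then have "(3/2)\<^sup>2 \<le> y x" unfolding y_def by (simp only: power2_abs)
      moreover have "(2::real) \<le> (3/2)\<^sup>2" by (simp add: power2_eq_square)
      ultimately have "y x \<ge> 2" by linarith
      then show ?thesis using h0 by simp
    qed
  qed
qed

text \<open>The reflected series needs derivatives bounded on the whole line. Multiplication by a
  plateau gives compact support without changing the germ of \<open>g\<close> at
  \<open>t0\<close>.\<close>

lemma smooth_cutoff:
  fixes g :: "real \<Rightarrow> real"
  assumes S: "open S" "smooth_on S g" "t0 \<in> S"
  obtains G d where "d > 0" "\<And>n x. (G n has_real_derivative G (Suc n) x) (at x)"
    "\<And>n::nat. \<exists>M. \<forall>x. \<bar>G n x\<bar> \<le> M"
    "\<And>x n. \<bar>x - t0\<bar> < d \<Longrightarrow> x \<in> S \<and> G n x = (deriv ^^ n) g x"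
proof -
  obtain e where e: "e > 0" "ball t0 e \<subseteq> S" using S openE by blast
  define r where "r = e / 2"
  have r: "r > 0" using e by (simp add: r_def)
  obtain \<eta> where \<eta>: "smooth_on UNIV \<eta>" "\<And>x. \<bar>x - t0\<bar> \<le> r \<Longrightarrow> \<eta> x = (1::real)" "\<And>x. \<bar>x - t0\<bar> \<ge> 3/2 * r \<Longrightarrow> \<eta> x = 0"
    using smooth_plateau[OF r] by metis
  define G0 where "G0 x = (if x \<in> ball t0 e then \<eta> x * g x else 0)" for x
  have out: "G0 x = 0" if "x \<in> - cball t0 (3/2 * r)" for x
    using that \<eta>(3)[of x] by (auto simp: G0_def dist_real_def abs_minus_commute)
  have "smooth_on (ball t0 e) G0"
    by (rule smooth_on_cong[of _ "\<lambda>x. \<eta> x * g x"])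
       (auto simp: G0_def intro!: smooth_on_mult smooth_on_subset[OF \<eta>(1)] smooth_on_subset[OF S(2) e(2)])
  moreover have "smooth_on (- cball t0 (3/2 * r)) G0"
    by (rule smooth_on_cong[of _ "\<lambda>x. 0"]) (use out in \<open>auto intro: smooth_on_const\<close>)
  \<comment> \<open>Since \<open>r = e / 2\<close>, the support radius 3e/4 is smaller than
    \<open>e\<close>, so the two open sets on which \<open>G0\<close> is smooth overlap.\<close>
  moreover have "ball t0 e \<union> - cball t0 (3/2 * r) = UNIV" using e by (auto simp: r_def)
  ultimately have G0: "smooth_on UNIV G0" using smooth_on_Un[of "ball t0 e" "- cball t0 (3/2 * r)" G0] by auto
  have Gs: "smooth_on UNIV ((deriv ^^ n) G0)" for n by (rule smooth_on_deriv_funpow[OF _ G0]) simp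
  show ?thesis
  proof (rule that[of r "\<lambda>n. (deriv ^^ n) G0"])
    show "((deriv ^^ n) G0 has_real_derivative (deriv ^^ Suc n) G0 x) (at x)" for n x
      using smooth_on_deriv[OF Gs] by simp
    show "\<exists>M. \<forall>x. \<bar>(deriv ^^ n) G0 x\<bar> \<le> M" for n
    proof -
      have "compact ((deriv ^^ n) G0 ` cball t0 (3/2 * r))"
        by (intro compact_continuous_image continuous_on_subset[OF smooth_on_imp_continuous_on[OF Gs]]) auto
      then have "bounded ((deriv ^^ n) G0 ` cball t0 (3/2 * r))" by (rule compact_imp_bounded)
      then obtain M where M: "\<forall>x\<in>cball t0 (3/2 * r). \<bar>(deriv ^^ n) G0 x\<bar> \<le> M"
        unfolding bounded_iff by auto
      have "(deriv ^^ n) G0 x = 0" if "x \<in> - cball t0 (3/2 * r)" for x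
      proof -
        have z: "(deriv ^^ n) (\<lambda>x. 0::real) = (\<lambda>x. 0)" by (induction n) auto
        show ?thesis
          using deriv_funpow_cong_open[of "- cball t0 (3/2 * r)" G0 "\<lambda>x. 0" x n] out that z by auto
      qed
      then have "\<bar>(deriv ^^ n) G0 x\<bar> \<le> max M 0" for x
        using M by (cases "x \<in> cball t0 (3/2 * r)") fastforce+
      then show ?thesis by blast
    qed
    show "x \<in> S \<and> (deriv ^^ n) G0 x = (deriv ^^ n) g x" if "\<bar>x - t0\<bar> < r" for x n
    proof -
      have sub: "ball t0 r \<subseteq> ball t0 e" using e by (auto simp: r_def)
      have "G0 y = g y" if "y \<in> ball t0 r" for y
        using that sub \<eta>(2)[of y] by (auto simp: G0_def dist_real_def abs_minus_commute)
      moreover have "x \<in> ball t0 r" using that by (simp add: dist_real_def abs_minus_commute)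
      ultimately show ?thesis using deriv_funpow_cong_open[of "ball t0 r" G0 g x n] e sub by blast
    qed
  qed (rule r)
qed

subsection \<open>Even functions as functions of the square\<close>

text \<open>A symmetrised Taylor remainder with kernel \<kappa>: it is even in \<open>w\<close>,
  hence a candidate for a smooth function of the square of \<open>w\<close>.\<close>

definition sym_integral :: "(real \<Rightarrow> real) \<Rightarrow> (real \<Rightarrow> real) \<Rightarrow> real \<Rightarrow> real \<Rightarrow> real" where
  "sym_integral \<kappa> g x w = integral {0..1} (\<lambda>r. \<kappa> r * (g (x + r * w) + g (x - r * w)))"

lemma sym_integral_minus: "sym_integral \<kappa> g x (- w) = sym_integral \<kappa> g x w"
  by (simp add: sym_integral_def add.commute)

lemma continuous_sym_integral:
  assumes "continuous_on {0..1} \<kappa>" "continuous_on UNIV g"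
  shows "continuous_on UNIV (\<lambda>(x, w). sym_integral \<kappa> g x w)"
proof -
  have "continuous_on (UNIV \<times> cbox 0 1) (\<lambda>(p, r). \<kappa> r * (g (fst p + r * snd p) + g (fst p - r * snd p)))"
    unfolding split_beta
    by (intro continuous_intros continuous_on_compose2[OF assms(1)] continuous_on_compose2[OF assms(2)]) auto
  from integral_continuous_on_param[OF this] show ?thesis
    by (simp add: sym_integral_def split_beta)
qed

lemma sym_integral_bound:
  assumes "continuous_on {0..1} \<kappa>" "continuous_on UNIV g" "\<And>x. \<bar>g x\<bar> \<le> M"
  shows "\<exists>B. \<forall>x w. \<bar>sym_integral \<kappa> g x w\<bar> \<le> B"
proof -
  have "bounded (\<kappa> ` {0..1})" using assms(1) by (intro compact_imp_bounded compact_continuous_image) auto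
  then obtain K where K: "\<And>r. r \<in> {0..1} \<Longrightarrow> \<bar>\<kappa> r\<bar> \<le> K" unfolding bounded_iff by force
  have "norm (sym_integral \<kappa> g x w) \<le> (K * (2 * M)) * (1 - 0)" for x w
    unfolding sym_integral_def
  proof (rule integral_bound)
    show "continuous_on {0..1} (\<lambda>r. \<kappa> r * (g (x + r * w) + g (x - r * w)))"
      by (intro continuous_intros assms(1) continuous_on_compose2[OF assms(2)]) auto
    show "norm (\<kappa> r * (g (x + r * w) + g (x - r * w))) \<le> K * (2 * M)" if "r \<in> {0..1}" for r
    proof -
      have "\<bar>g (x + r * w) + g (x - r * w)\<bar> \<le> 2 * M" using assms(3)[of "x + r * w"] assms(3)[of "x - r * w"] by linarith
      then show ?thesis unfolding real_norm_def abs_mult using K[OF that] by (intro mult_mono) auto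
    qed
  qed simp
  then show ?thesis by auto
qed

lemma DERIV_sym_integral_base:
  assumes "continuous_on {0..1} \<kappa>" "\<And>x. (g has_real_derivative g' x) (at x)" "continuous_on UNIV g'"
  shows "((\<lambda>x. sym_integral \<kappa> g x w) has_real_derivative sym_integral \<kappa> g' x w) (at x)"
proof -
  have g: "continuous_on UNIV g" using assms(2) by (auto intro!: DERIV_continuous_on)
  have "((\<lambda>x. integral (cbox 0 1) (\<lambda>r. \<kappa> r * (g (x + r * w) + g (x - r * w)))) has_real_derivative
      integral (cbox 0 1) (\<lambda>r. \<kappa> r * (g' (x + r * w) + g' (x - r * w)))) (at x within UNIV)"
  proof (rule leibniz_rule_field_derivative)
    show "((\<lambda>x. \<kappa> r * (g (x + r * w) + g (x - r * w))) has_real_derivative \<kappa> r * (g' (x + r * w) + g' (x - r * w))) (at x within UNIV)" for x r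
      by (auto intro!: derivative_eq_intros DERIV_chain2[OF assms(2)])
    show "(\<lambda>r. \<kappa> r * (g (x + r * w) + g (x - r * w))) integrable_on cbox 0 1" for x
      unfolding cbox_interval
      by (intro integrable_continuous_real continuous_intros assms(1) continuous_on_compose2[OF g]) auto
    show "continuous_on (UNIV \<times> cbox 0 1) (\<lambda>(x, r). \<kappa> r * (g' (x + r * w) + g' (x - r * w)))"
      unfolding split_beta
      by (intro continuous_intros continuous_on_compose2[OF assms(1)] continuous_on_compose2[OF assms(3)]) auto
  qed auto
  then show ?thesis by (simp add: sym_integral_def)
qed

text \<open>Integration by parts: with \<open>y = w\<^sup>2\<close> the right-hand side says that \<open>\<partial>/\<partial>y\<close> replaces the kernel
  \<open>\<kappa>\<close> by \<open>\<kappa>1\<close> and \<open>g\<close> by \<open>g''\<close>, so no singularity appears at \<open>w = 0\<close>.\<close>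

lemma DERIV_sym_integral_step:
  assumes "continuous_on {0..1} \<kappa>" "continuous_on {0..1} \<kappa>1"
    and \<kappa>1: "\<And>r. r \<in> {0..1} \<Longrightarrow> (\<kappa>1 has_real_derivative - (r * \<kappa> r) / 2) (at r within {0..1})" "\<kappa>1 1 = 0"
    and g: "\<And>x. (g has_real_derivative g1 x) (at x)" "\<And>x. (g1 has_real_derivative g2 x) (at x)" "continuous_on UNIV g2"
  shows "((\<lambda>w. sym_integral \<kappa> g x w) has_real_derivative 2 * w * sym_integral \<kappa>1 g2 x w) (at w)"
proof -
  have gc: "continuous_on UNIV g" "continuous_on UNIV g1" using g by (auto intro!: DERIV_continuous_on)
  have int: "(\<lambda>r. \<kappa> r * (r * (g1 (x + r * w) - g1 (x - r * w)))) integrable_on {0..1}"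
    by (intro integrable_continuous_real continuous_intros assms(1) continuous_on_compose2[OF gc(2)]) auto
  have int2: "(\<lambda>r. \<kappa>1 r * (g2 (x + r * w) + g2 (x - r * w))) integrable_on {0..1}"
    by (intro integrable_continuous_real continuous_intros assms(2) continuous_on_compose2[OF g(3)]) auto
  have "((\<lambda>w. integral (cbox 0 1) (\<lambda>r. \<kappa> r * (g (x + r * w) + g (x - r * w)))) has_real_derivative
      integral (cbox 0 1) (\<lambda>r. \<kappa> r * (r * (g1 (x + r * w) - g1 (x - r * w))))) (at w within UNIV)"
  proof (rule leibniz_rule_field_derivative)
    show "((\<lambda>w. \<kappa> r * (g (x + r * w) + g (x - r * w))) has_real_derivative \<kappa> r * (r * (g1 (x + r * w) - g1 (x - r * w)))) (at w within UNIV)" for w r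
      by (auto intro!: derivative_eq_intros DERIV_chain2[OF g(1)] simp: algebra_simps)
    show "(\<lambda>r. \<kappa> r * (g (x + r * w) + g (x - r * w))) integrable_on cbox 0 1" for w
      unfolding cbox_interval
      by (intro integrable_continuous_real continuous_intros assms(1) continuous_on_compose2[OF gc(1)]) auto
    show "continuous_on (UNIV \<times> cbox 0 1) (\<lambda>(w, r). \<kappa> r * (r * (g1 (x + r * w) - g1 (x - r * w))))"
      unfolding split_beta
      by (intro continuous_intros continuous_on_compose2[OF assms(1)] continuous_on_compose2[OF gc(2)]) auto
  qed auto
  moreover have "integral {0..1} (\<lambda>r. \<kappa> r * (r * (g1 (x + r * w) - g1 (x - r * w)))) = 2 * w * sym_integral \<kappa>1 g2 x w"
  proof -
    \<comment> \<open>The boundary terms vanish: at 1 because \<kappa>1 does, at 0 because the two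
      values of \<open>g1\<close> coincide.\<close>
    let ?u = "\<lambda>r. \<kappa>1 r * (g1 (x + r * w) - g1 (x - r * w))"
    let ?u' = "\<lambda>r. w * (\<kappa>1 r * (g2 (x + r * w) + g2 (x - r * w))) - \<kappa> r * (r * (g1 (x + r * w) - g1 (x - r * w))) / 2"
    have "(?u' has_integral (?u 1 - ?u 0)) {0..1}"
    proof (rule fundamental_theorem_of_calculus)
      fix r :: real assume r: "r \<in> {0..1}"
      have "((\<lambda>r. g1 (x + r * w) - g1 (x - r * w)) has_real_derivative w * (g2 (x + r * w) + g2 (x - r * w))) (at r within {0..1})"
        by (auto intro!: derivative_eq_intros DERIV_chain2[OF g(2)] simp: algebra_simps)
      from DERIV_mult[OF \<kappa>1(1)[OF r] this]
      show "(?u has_vector_derivative ?u' r) (at r within {0..1})"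
        unfolding has_real_derivative_iff_has_vector_derivative[symmetric]
        by (rule back_subst[of "\<lambda>d. (_ has_real_derivative d) _"]) (simp add: field_simps)
    qed simp
    then have "(?u' has_integral 0) {0..1}" using \<kappa>1(2) by simp
    moreover have "(?u' has_integral (w * sym_integral \<kappa>1 g2 x w - integral {0..1} (\<lambda>r. \<kappa> r * (r * (g1 (x + r * w) - g1 (x - r * w)))) / 2)) {0..1}"
      unfolding sym_integral_def
      by (intro has_integral_diff has_integral_mult_right has_integral_divide integrable_integral int int2)
    ultimately have "w * sym_integral \<kappa>1 g2 x w - integral {0..1} (\<lambda>r. \<kappa> r * (r * (g1 (x + r * w) - g1 (x - r * w)))) / 2 = 0"
      by (rule has_integral_unique[symmetric])
    then show ?thesis by simp
  qed
  ultimately show ?thesis by (simp add: sym_integral_def)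
qed

text \<open>The antiderivative of \<open>- r * \<kappa> r / 2\<close> that vanishes at 1, iterated:
  these are the kernels left after \<open>m\<close> derivatives with respect to the square of
  \<open>w\<close>.\<close>

primrec iterated_kernel :: "(real \<Rightarrow> real) \<Rightarrow> nat \<Rightarrow> real \<Rightarrow> real" where
  "iterated_kernel \<kappa> 0 = \<kappa>"
| "iterated_kernel \<kappa> (Suc m) = (\<lambda>r. integral {r..1} (\<lambda>s. s * iterated_kernel \<kappa> m s) / 2)"

lemma continuous_kernel: "continuous_on {0..1} \<kappa> \<Longrightarrow> continuous_on {0..1} (iterated_kernel \<kappa> m)"
  and DERIV_kernel: "continuous_on {0..1} \<kappa> \<Longrightarrow> r \<in> {0..1} \<Longrightarrow>
    (iterated_kernel \<kappa> (Suc m) has_real_derivative - (r * iterated_kernel \<kappa> m r) / 2) (at r within {0..1})"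
proof -
  have d: "(iterated_kernel \<kappa> (Suc m) has_real_derivative - (r * iterated_kernel \<kappa> m r) / 2) (at r within {0..1})"
    if "continuous_on {0..1} (iterated_kernel \<kappa> m)" "r \<in> {0..1}" for m r
    unfolding iterated_kernel.simps
    by (intro DERIV_cdivide integral_has_real_derivative' continuous_intros that)
  show c: "continuous_on {0..1} (iterated_kernel \<kappa> m)" if "continuous_on {0..1} \<kappa>" for m
  proof (induction m)
    case (Suc m)
    show ?case by (rule DERIV_continuous_on[OF d[OF Suc]])
  qed (use that in simp)
  show "(iterated_kernel \<kappa> (Suc m) has_real_derivative - (r * iterated_kernel \<kappa> m r) / 2) (at r within {0..1})"
    if "continuous_on {0..1} \<kappa>" "r \<in> {0..1}"
    using d c that by blast
qed

text \<open>Whitney's argument: in y = w^2 each derivative advances the kernel and differentiates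
  \<open>g\<close> twice more, so all derivatives stay bounded and continuous up to y = 0, and the
  reflection continues them to negative y.\<close>

lemma sym_integral_even_smooth:
  assumes \<kappa>: "continuous_on {0..1} \<kappa>"
    and g: "\<And>n x. (g n has_real_derivative g (Suc n) x) (at x)" "\<And>n::nat. \<exists>M. \<forall>x. \<bar>g n x\<bar> \<le> M"
  obtains E where "smooth_on UNIV E" "\<And>x w. E (x, w\<^sup>2) = sym_integral \<kappa> (g 0) x w"
proof -
  have gc: "continuous_on UNIV (g n)" for n using g(1) by (auto intro!: DERIV_continuous_on)
  define A where "A i m p = sym_integral (iterated_kernel \<kappa> m) (g (i + 2 * m)) (fst p) (sqrt (snd p))" for i m p
  obtain E where E: "smooth_on UNIV E" "\<And>x y. y \<ge> 0 \<Longrightarrow> E (x, y) = A 0 0 (x, y)"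
  proof (rule seeley_extension[of A])
    fix i m
    have "continuous_on UNIV (\<lambda>p. case (fst p, sqrt (snd p)) of (x, w) \<Rightarrow> sym_integral (iterated_kernel \<kappa> m) (g (i + 2 * m)) x w)"
      by (rule continuous_on_compose2[OF continuous_sym_integral[OF continuous_kernel[OF \<kappa>] gc]]) (auto intro!: continuous_intros)
    then show "continuous_on (UNIV \<times> {0..}) (A i m)"
      unfolding A_def[abs_def] by (auto elim: continuous_on_subset)
    obtain M where "\<And>x. \<bar>g (i + 2 * m) x\<bar> \<le> M" using g(2) by blast
    then obtain B where "\<And>x w. \<bar>sym_integral (iterated_kernel \<kappa> m) (g (i + 2 * m)) x w\<bar> \<le> B"
      using sym_integral_bound[OF continuous_kernel[OF \<kappa>] gc] by blast
    then show "\<exists>M. \<forall>x y. y \<ge> 0 \<longrightarrow> \<bar>A i m (x, y)\<bar> \<le> M"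
      by (auto simp: A_def)
    fix x y :: real
    show "((\<lambda>a. A i m (a, y)) has_real_derivative A (Suc i) m (x, y)) (at x)"
      using DERIV_sym_integral_base[OF continuous_kernel[OF \<kappa>] g(1) gc] by (simp add: A_def)
    assume y: "y > 0"
    let ?S = "sym_integral (iterated_kernel \<kappa> (Suc m)) (g (Suc (Suc (i + 2 * m)))) x"
    have h: "(sym_integral (iterated_kernel \<kappa> m) (g (i + 2 * m)) x has_real_derivative 2 * w * ?S w) (at w)" for w
      by (rule DERIV_sym_integral_step[OF continuous_kernel[OF \<kappa>] continuous_kernel[OF \<kappa>] DERIV_kernel[OF \<kappa>] _ g(1) g(1) gc]) simp_all
    have "((\<lambda>b. sym_integral (iterated_kernel \<kappa> m) (g (i + 2 * m)) x (sqrt b)) has_real_derivative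
        2 * sqrt y * ?S (sqrt y) * (inverse (sqrt y) / 2)) (at y)"
      by (rule DERIV_chain2[OF h DERIV_real_sqrt[OF y]])
    \<comment> \<open>The factor 2w from the integration by parts cancels the singular derivative of
      the square root.\<close>
    moreover have "2 * sqrt y * ?S (sqrt y) * (inverse (sqrt y) / 2) = ?S (sqrt y)" using y by simp
    ultimately have "((\<lambda>b. sym_integral (iterated_kernel \<kappa> m) (g (i + 2 * m)) x (sqrt b)) has_real_derivative ?S (sqrt y)) (at y)"
      by metis
    then show "((\<lambda>b. A i m (x, b)) has_real_derivative A i (Suc m) (x, y)) (at y)"
      by (simp add: A_def)
  qed blast
  have "E (x, w\<^sup>2) = sym_integral \<kappa> (g 0) x w" for x w
    using E(2)[of "w\<^sup>2" x] sym_integral_minus[of \<kappa> "g 0" x w] by (cases "w \<ge> 0") (auto simp: A_def)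
  then show ?thesis using that E(1) by blast
qed

text \<open>Taylor's formula with integral remainder, of order two for the even part and of order
  three for the odd part. Averaging over w and -w produces the kernels (1 - r)/2 and (1 -
  r)^2/4.\<close>

lemma smooth_even_odd_expansion:
  fixes g :: "nat \<Rightarrow> real \<Rightarrow> real"
  assumes g: "\<And>n x. (g n has_real_derivative g (Suc n) x) (at x)" "\<And>n. \<exists>M. \<forall>x. \<bar>g n x\<bar> \<le> M"
  obtains Q P where "smooth_on UNIV Q" "smooth_on UNIV P"
    "\<And>x w. g 0 (x + w) = g 0 x + w * g 1 x + w\<^sup>2 * Q (x, w\<^sup>2) + w ^ 3 * P (x, w\<^sup>2)"
    "\<And>x. Q (x, 0) = g 2 x / 2" "\<And>x. P (x, 0) = g 3 x / 6"
proof -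
  have gc: "continuous_on UNIV (g n)" for n using g(1) by (auto intro!: DERIV_continuous_on)
  have k: "continuous_on {0..1} (\<lambda>r::real. (1 - r) / 2)" "continuous_on {0..1} (\<lambda>r::real. (1 - r)\<^sup>2 / 4)"
    by (intro continuous_intros; simp)+
  have gn: "(g (n + m) has_real_derivative g (Suc n + m) x) (at x)" for n m x
    using g(1)[of "n + m" x] by simp
  obtain Q where Q: "smooth_on UNIV Q" "\<And>x w. Q (x, w\<^sup>2) = sym_integral (\<lambda>r. (1 - r) / 2) (g (0 + 2)) x w"
    using sym_integral_even_smooth[OF k(1), of "\<lambda>n. g (n + 2)", OF gn g(2)] by blast
  obtain P where P: "smooth_on UNIV P" "\<And>x w. P (x, w\<^sup>2) = sym_integral (\<lambda>r. (1 - r)\<^sup>2 / 4) (g (0 + 3)) x w"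
    using sym_integral_even_smooth[OF k(2), of "\<lambda>n. g (n + 3)", OF gn g(2)] by blast
  note Q' = Q(2)[unfolded add_0] and P' = P(2)[unfolded add_0]
  have d1: "((\<lambda>r. g n (x + r * w)) has_real_derivative w * g (Suc n) (x + r * w)) (at r within {0..1})"
    and d2: "((\<lambda>r. g n (x - r * w)) has_real_derivative - (w * g (Suc n) (x - r * w))) (at r within {0..1})" for n x w r
  proof -
    have "((\<lambda>r. g n (x + r * w)) has_real_derivative g (Suc n) (x + r * w) * w) (at r)" for w
      by (rule DERIV_chain2[OF g(1)]) (auto intro!: derivative_eq_intros)
    from this[of w] this[of "- w"] show
      "((\<lambda>r. g n (x + r * w)) has_real_derivative w * g (Suc n) (x + r * w)) (at r within {0..1})"
      "((\<lambda>r. g n (x - r * w)) has_real_derivative - (w * g (Suc n) (x - r * w))) (at r within {0..1})"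
      by (simp_all add: mult.commute has_field_derivative_at_within)
  qed
  have Suc_eq: "Suc 0 = 1" "Suc 1 = 2" "Suc 2 = 3" by simp_all
  note d = d1[of 0, unfolded Suc_eq] d1[of 1, unfolded Suc_eq] d1[of 2, unfolded Suc_eq]
    d2[of 0, unfolded Suc_eq] d2[of 1, unfolded Suc_eq] d2[of 2, unfolded Suc_eq]
  have even: "w\<^sup>2 * Q (x, w\<^sup>2) = (g 0 (x + w) + g 0 (x - w)) / 2 - g 0 x" for x w
  proof -
    \<comment> \<open>An antiderivative from integration by parts, equal to the even part of
      \<open>g 0 (x + w)\<close> at 1 and to \<open>g 0 x\<close> at 0.\<close>
    let ?U = "\<lambda>r. (1 - r) * w * (g 1 (x + r * w) - g 1 (x - r * w)) / 2 + (g 0 (x + r * w) + g 0 (x - r * w)) / 2"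
    let ?f = "\<lambda>r. (1 - r) / 2 * (g 2 (x + r * w) + g 2 (x - r * w))"
    have "((\<lambda>r. w\<^sup>2 * ?f r) has_integral ?U 1 - ?U 0) {0..1}"
    proof (rule fundamental_theorem_of_calculus)
      fix r :: real
      have "(?U has_real_derivative w\<^sup>2 * ?f r) (at r within {0..1})"
        by (auto intro!: derivative_eq_intros d simp del: One_nat_def simp: field_simps power2_eq_square)
      then show "(?U has_vector_derivative w\<^sup>2 * ?f r) (at r within {0..1})"
        by (simp add: has_real_derivative_iff_has_vector_derivative)
    qed simp
    moreover have "((\<lambda>r. w\<^sup>2 * ?f r) has_integral w\<^sup>2 * sym_integral (\<lambda>r. (1 - r) / 2) (g 2) x w) {0..1}"
      unfolding sym_integral_def
      by (intro has_integral_mult_right integrable_integral integrable_continuous_real continuous_intros continuous_on_compose2[OF gc]) auto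
    ultimately have "?U 1 - ?U 0 = w\<^sup>2 * sym_integral (\<lambda>r. (1 - r) / 2) (g 2) x w" by (rule has_integral_unique)
    then show ?thesis by (simp add: Q')
  qed
  have odd: "w ^ 3 * P (x, w\<^sup>2) = (g 0 (x + w) - g 0 (x - w)) / 2 - w * g 1 x" for x w
  proof -
    \<comment> \<open>Here the value at 1 is the odd part and the value at 0 is
      \<open>w * g 1 x\<close>.\<close>
    let ?U = "\<lambda>r. (1 - r)\<^sup>2 * w\<^sup>2 * (g 2 (x + r * w) - g 2 (x - r * w)) / 4
      + (1 - r) * w * (g 1 (x + r * w) + g 1 (x - r * w)) / 2 + (g 0 (x + r * w) - g 0 (x - r * w)) / 2"
    let ?f = "\<lambda>r. (1 - r)\<^sup>2 / 4 * (g 3 (x + r * w) + g 3 (x - r * w))"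
    have "((\<lambda>r. w ^ 3 * ?f r) has_integral ?U 1 - ?U 0) {0..1}"
    proof (rule fundamental_theorem_of_calculus)
      fix r :: real
      have "(?U has_real_derivative w ^ 3 * ?f r) (at r within {0..1})"
        by (auto intro!: derivative_eq_intros d simp del: One_nat_def simp: field_simps power2_eq_square power3_eq_cube)
      then show "(?U has_vector_derivative w ^ 3 * ?f r) (at r within {0..1})"
        by (simp add: has_real_derivative_iff_has_vector_derivative)
    qed simp
    moreover have "((\<lambda>r. w ^ 3 * ?f r) has_integral w ^ 3 * sym_integral (\<lambda>r. (1 - r)\<^sup>2 / 4) (g 3) x w) {0..1}"
      unfolding sym_integral_def
      by (intro has_integral_mult_right integrable_integral integrable_continuous_real continuous_intros continuous_on_compose2[OF gc]) auto
    ultimately have "?U 1 - ?U 0 = w ^ 3 * sym_integral (\<lambda>r. (1 - r)\<^sup>2 / 4) (g 3) x w" by (rule has_integral_unique)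
    then show ?thesis by (simp add: P')
  qed
  show ?thesis
  proof (rule that[OF Q(1) P(1)])
    show "g 0 (x + w) = g 0 x + w * g 1 x + w\<^sup>2 * Q (x, w\<^sup>2) + w ^ 3 * P (x, w\<^sup>2)" for x w
      unfolding even odd by (simp add: field_simps)
    fix x
    have "((\<lambda>r. 1 - r) has_integral ((\<lambda>r. r - r\<^sup>2 / 2) 1 - (\<lambda>r. r - r\<^sup>2 / 2) 0)) {0..1::real}"
      by (rule fundamental_theorem_of_calculus)
         (auto simp: has_real_derivative_iff_has_vector_derivative[symmetric] intro!: derivative_eq_intros)
    from integral_unique[OF this] show "Q (x, 0) = g 2 x / 2"
      using Q'[of x 0] by (simp add: sym_integral_def)
    have "((\<lambda>r. (1 - r)\<^sup>2) has_integral ((\<lambda>r. - ((1 - r) ^ 3 / 3)) 1 - (\<lambda>r. - ((1 - r) ^ 3 / 3)) 0)) {0..1::real}"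
      by (rule fundamental_theorem_of_calculus)
         (auto simp: has_real_derivative_iff_has_vector_derivative[symmetric] intro!: derivative_eq_intros)
    from integral_unique[OF this] have "integral {0..1} (\<lambda>r::real. (1 - r)\<^sup>2) = 1 / 3" by simp
    then show "P (x, 0) = g 3 x / 6"
      using P'[of x 0] by (simp add: sym_integral_def del: divide_eq_eq_numeral1 eq_divide_eq_numeral1)
  qed
qed

subsection \<open>Local diffeomorphisms\<close>

lemma open_vimage_Int: "open S \<Longrightarrow> continuous_on S f \<Longrightarrow> open T \<Longrightarrow> open {x \<in> S. f x \<in> T}"
  using continuous_open_preimage[of S f T] by (simp add: Int_def vimage_def)

lemma DERIV_partial_snd:
  fixes F :: "'a::euclidean_space \<times> real \<Rightarrow> real"
  assumes "smooth_on S F" "(p, t) \<in> S"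
  shows "((\<lambda>t. F (p, t)) has_real_derivative frechet_derivative F (at (p, t)) (0, 1)) (at t)"
proof -
  let ?D = "frechet_derivative F (at (p, t))"
  have D: "(F has_derivative ?D) (at (p, t))" by (rule smooth_on_derivative[OF assms])
  have "((\<lambda>t. (p, t)) has_derivative (\<lambda>h. (0, h))) (at t)"
    by (intro has_derivative_Pair has_derivative_const has_derivative_ident)
  from diff_chain_at[OF this D]
  have "((\<lambda>t. F (p, t)) has_derivative (\<lambda>h. ?D (0, h))) (at t)" by (simp add: o_def)
  moreover have "(\<lambda>h. ?D (0, h)) = (*) (?D (0, 1))"
  proof
    show "?D (0, h) = ?D (0, 1) * h" for h
      using linear_cmul[OF has_derivative_linear[OF D], of h "(0, 1)"] by simp
  qed
  ultimately show ?thesis unfolding has_field_derivative_def by simp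
qed

text \<open>Where the last partial derivative of \<open>F\<close> is nonzero, the derivative is
  triangular and inverts by one division. The shift \<open>c\<close> lets source coordinates be
  centred at zero.\<close>

lemma triangular_local_diffeomorphism:
  fixes F :: "'a::euclidean_space \<times> real \<Rightarrow> real"
  assumes S: "open S" "smooth_on S F" "q0 \<in> S" and nz: "frechet_derivative F (at q0) (0, 1) \<noteq> 0"
  obtains U V g where "U \<subseteq> S" "q0 \<in> U" "diffeomorphism U V (\<lambda>q. (c + fst q, F q)) g"
proof -
  define D where "D q = frechet_derivative F (at q)" for q
  have Ds: "smooth_on S (\<lambda>q. D q v)" for v
    unfolding D_def by (rule smooth_on_frechet_derivative[OF S(2)])
  define S' where "S' = {q \<in> S. D q (0, 1) \<in> - {0}}"
  have S': "open S'" "S' \<subseteq> S" "q0 \<in> S'"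
    using S(3) nz open_vimage_Int[OF S(1) smooth_on_imp_continuous_on[OF Ds], of "- {0}"] by (auto simp: S'_def D_def)
  have lin: "D q (v, h) = D q (v, 0) + h * D q (0, 1)" if "q \<in> S'" for q v h
  proof -
    have l: "linear (D q)"
      unfolding D_def using smooth_on_derivative[OF S(2)] S'(2) that has_derivative_linear by blast
    have "D q (v, h) = D q ((v, 0) + h *\<^sub>R (0, 1))" by simp
    also have "\<dots> = D q (v, 0) + h * D q (0, 1)" using linear_add[OF l, of "(v, 0)" "h *\<^sub>R (0, 1)"] linear_cmul[OF l, of h "(0, 1)"] by simp
    finally show ?thesis .
  qed
  show ?thesis
  proof (rule smooth_inverse_function[of S' "\<lambda>q. (c + fst q, F q)" q0
        "\<lambda>q v. (fst v, D q v)" "\<lambda>q v. (fst v, (snd v - D q (fst v, 0)) / D q (0, 1))"])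
    show "smooth_on S' (\<lambda>q. (c + fst q, F q))"
      by (intro smooth_on_intros S' smooth_on_subset[OF S(2)])
    show "((\<lambda>q. (c + fst q, F q)) has_derivative (\<lambda>v. (fst v, D q v))) (at q)" if "q \<in> S'" for q
      using smooth_on_derivative[OF S(2), of q] S'(2) that
      by (auto simp: D_def intro!: derivative_eq_intros)
    show "(fst (fst v, D q v), (snd (fst v, D q v) - D q (fst (fst v, D q v), 0)) / D q (0, 1)) = v" if "q \<in> S'" for q v
      using that lin[OF that, of "fst v" "snd v"] by (simp add: S'_def prod_eq_iff)
    show "(fst (fst v, (snd v - D q (fst v, 0)) / D q (0, 1)), D q (fst v, (snd v - D q (fst v, 0)) / D q (0, 1))) = v" if "q \<in> S'" for q v
      using that lin[OF that, of "fst v" "(snd v - D q (fst v, 0)) / D q (0, 1)"] by (simp add: S'_def prod_eq_iff)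
    show "smooth_on S' (\<lambda>q. (fst v, (snd v - D q (fst v, 0)) / D q (0, 1)))" for v
      by (intro smooth_on_intros S' smooth_on_subset[OF Ds]) (auto simp: S'_def)
  qed (use S' that in blast)+
qed

text \<open>Invert \<open>(p, t) \<mapsto> (p, F (p, t))\<close> and read \<sigma> off the slice
  where the last coordinate is zero.\<close>

lemma implicit_function_smooth:
  fixes F :: "'a::euclidean_space \<times> real \<Rightarrow> real"
  assumes S: "open S" "smooth_on S F" "(p0, t0) \<in> S" and "F (p0, t0) = 0"
    and nz: "frechet_derivative F (at (p0, t0)) (0, 1) \<noteq> 0"
  obtains U \<sigma> where "open U" "p0 \<in> U" "smooth_on U \<sigma>" "\<sigma> p0 = t0"
    "\<And>p. p \<in> U \<Longrightarrow> (p, \<sigma> p) \<in> S \<and> F (p, \<sigma> p) = 0"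
proof -
  obtain U V g where h: "U \<subseteq> S" "(p0, t0) \<in> U" "diffeomorphism U V (\<lambda>q. (0 + fst q, F q)) g"
    using triangular_local_diffeomorphism[OF S nz] by metis
  have V: "open V" "smooth_on V g" and hom: "homeomorphism U V (\<lambda>q. (fst q, F q)) g"
    using h(3) by (auto simp: diffeomorphism_def)
  define U' where "U' = {p. (p, 0::real) \<in> V}"
  have cont: "continuous_on UNIV (\<lambda>p::'a. (p, 0::real))" by (intro continuous_intros)
  have gV: "g y \<in> U" "(fst (g y), F (g y)) = y" if "y \<in> V" for y
    using hom that unfolding homeomorphism_def by blast+
  show ?thesis
  proof (rule that[of U' "\<lambda>p. snd (g (p, 0))"])
    show o: "open U'" using open_vimage_Int[OF _ cont V(1)] by (simp add: U'_def)
    have "(p0, 0) \<in> V" "g (p0, 0) = (p0, t0)"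
      using hom h(2) \<open>F (p0, t0) = 0\<close> unfolding homeomorphism_def by (metis fst_conv imageI)+
    then show "p0 \<in> U'" "snd (g (p0, 0)) = t0" by (auto simp: U'_def)
    show "smooth_on U' (\<lambda>p. snd (g (p, 0)))"
      by (intro smooth_on_snd smooth_on_compose[OF o V(1) V(2)] smooth_on_Pair smooth_on_const smooth_on_ident o)
         (simp add: U'_def)
    show "(p, snd (g (p, 0))) \<in> S \<and> F (p, snd (g (p, 0))) = 0" if "p \<in> U'" for p
    proof -
      have "(p, 0) \<in> V" using that by (simp add: U'_def)
      then have "g (p, 0) \<in> U" "fst (g (p, 0)) = p" "F (g (p, 0)) = 0" using gV[of "(p, 0)"] by auto
      moreover then have "g (p, 0) = (p, snd (g (p, 0)))" by (simp add: prod_eq_iff)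
      ultimately show ?thesis using h(1) by (metis subsetD)
    qed
  qed
qed

lemma smooth_on_partials:
  fixes f :: "real \<times> real \<Rightarrow> real"
  assumes "smooth_on S f"
  obtains f1 f2 where "smooth_on S f1" "smooth_on S f2"
    "\<And>p. p \<in> S \<Longrightarrow> (f has_derivative (\<lambda>v. fst v * f1 p + snd v * f2 p)) (at p)"
proof (rule that[of "\<lambda>p. frechet_derivative f (at p) (1, 0)" "\<lambda>p. frechet_derivative f (at p) (0, 1)"])
  fix p assume p: "p \<in> S"
  let ?D = "frechet_derivative f (at p)"
  have D: "(f has_derivative ?D) (at p)" by (rule smooth_on_derivative[OF assms p])
  have l: "linear ?D" using has_derivative_linear[OF D] .
  have "?D = (\<lambda>v. fst v * ?D (1, 0) + snd v * ?D (0, 1))"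
  proof
    fix v
    have "?D v = ?D (fst v *\<^sub>R (1, 0) + snd v *\<^sub>R (0, 1))" by simp
    also have "\<dots> = fst v * ?D (1, 0) + snd v * ?D (0, 1)" by (simp only: linear_add[OF l] linear_cmul[OF l] real_scaleR_def)
    finally show "?D v = fst v * ?D (1, 0) + snd v * ?D (0, 1)" .
  qed
  then show "(f has_derivative (\<lambda>v. fst v * ?D (1, 0) + snd v * ?D (0, 1))) (at p)"
    by (rule has_derivative_eq_rhs[OF D])
qed (rule smooth_on_frechet_derivative[OF assms])+

text \<open>The map is affine in \<open>k\<close>, and its Jacobian determinant is the product of
  the \<open>l\<close>-derivative of \<open>Y\<close> with \<open>N\<close>, whatever the value of
  \<open>k\<close>.\<close>

lemma space_local_diffeomorphism:
  fixes Y M N :: "real \<times> real \<Rightarrow> real"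
  assumes U: "open U" "(u0, l0) \<in> U" and s: "smooth_on U Y" "smooth_on U M" "smooth_on U N"
    and Y: "((\<lambda>l. Y (u0, l)) has_real_derivative y') (at l0)" "y' \<noteq> 0" and N: "N (u0, l0) \<noteq> 0"
  obtains A B \<Psi>' where "(u0, l0, k0) \<in> A" "\<And>u l k. (u, l, k) \<in> A \<Longrightarrow> (u, l) \<in> U"
    "diffeomorphism A B (\<lambda>(u, l, k). (c + u, Y (u, l), M (u, l) + k * N (u, l))) \<Psi>'"
proof -
  define \<pi> where "\<pi> q = (fst q, fst (snd q))" for q :: "real \<times> real \<times> real"
  define \<kappa> where "\<kappa> q = snd (snd q)" for q :: "real \<times> real \<times> real"
  obtain Y1 Y2 where DY: "smooth_on U Y1" "smooth_on U Y2"
    "\<And>p. p \<in> U \<Longrightarrow> (Y has_derivative (\<lambda>v. fst v * Y1 p + snd v * Y2 p)) (at p)" using smooth_on_partials[OF s(1)] by blast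
  obtain M1 M2 where DM: "smooth_on U M1" "smooth_on U M2"
    "\<And>p. p \<in> U \<Longrightarrow> (M has_derivative (\<lambda>v. fst v * M1 p + snd v * M2 p)) (at p)" using smooth_on_partials[OF s(2)] by blast
  obtain N1 N2 where DN: "smooth_on U N1" "smooth_on U N2"
    "\<And>p. p \<in> U \<Longrightarrow> (N has_derivative (\<lambda>v. fst v * N1 p + snd v * N2 p)) (at p)" using smooth_on_partials[OF s(3)] by blast
  have "((\<lambda>l. Y (u0, l)) has_real_derivative frechet_derivative Y (at (u0, l0)) (0, 1)) (at l0)"
    by (rule DERIV_partial_snd[OF s(1) U(2)])
  moreover have "frechet_derivative Y (at (u0, l0)) = (\<lambda>v. fst v * Y1 (u0, l0) + snd v * Y2 (u0, l0))"
    using frechet_derivative_at[OF DY(3)[OF U(2)]] by simp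
  ultimately have Y2: "Y2 (u0, l0) \<noteq> 0" using Y DERIV_unique by fastforce
  define U' where "U' = {p \<in> {p \<in> U. Y2 p \<in> - {0}}. N p \<in> - {0}}"
  have o1: "open {p \<in> U. Y2 p \<in> - {0}}"
    by (rule open_vimage_Int[OF U(1) smooth_on_imp_continuous_on[OF DY(2)]]) auto
  have U': "open U'" unfolding U'_def
    by (rule open_vimage_Int[OF o1 continuous_on_subset[OF smooth_on_imp_continuous_on[OF s(3)]]]) auto
  define S where "S = {q. \<pi> q \<in> U'}"
  have "continuous_on UNIV \<pi>" unfolding \<pi>_def[abs_def] by (intro continuous_intros)
  then have S: "open S" using open_vimage_Int[of UNIV \<pi> U'] U' by (simp add: S_def)
  have \<pi>U: "\<pi> q \<in> U" "Y2 (\<pi> q) \<noteq> 0" "N (\<pi> q) \<noteq> 0" if "q \<in> S" for q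
    using that by (auto simp: S_def U'_def)
  have \<pi>s: "smooth_on S \<pi>" "smooth_on S \<kappa>"
    unfolding \<pi>_def[abs_def] \<kappa>_def[abs_def] by (intro smooth_on_intros S)+
  have comp: "smooth_on S (\<lambda>q. f (\<pi> q))" if "smooth_on U f" for f :: "real \<times> real \<Rightarrow> real"
    by (rule smooth_on_compose[OF S U(1) that \<pi>s(1) \<pi>U(1)])
  have D: "((\<lambda>q. f (\<pi> q)) has_derivative (\<lambda>v. fst v * f1 (\<pi> q) + fst (snd v) * f2 (\<pi> q))) (at q)"
    if "\<And>p. p \<in> U \<Longrightarrow> (f has_derivative (\<lambda>v. fst v * f1 p + snd v * f2 p)) (at p)" "q \<in> S"
    for f f1 f2 :: "real \<times> real \<Rightarrow> real" and q
  proof -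
    have "(\<pi> has_derivative \<pi>) (at q)" unfolding \<pi>_def[abs_def]
      by (auto intro!: derivative_eq_intros)
    from diff_chain_at[OF this that(1)[OF \<pi>U(1)[OF that(2)]]]
    show ?thesis by (simp add: o_def \<pi>_def)
  qed
  define \<Psi> where "\<Psi> q = (c + fst q, Y (\<pi> q), M (\<pi> q) + \<kappa> q * N (\<pi> q))" for q
  define L where "L q v = (fst v, fst v * Y1 (\<pi> q) + fst (snd v) * Y2 (\<pi> q),
      fst v * M1 (\<pi> q) + fst (snd v) * M2 (\<pi> q)
      + (\<kappa> q * (fst v * N1 (\<pi> q) + fst (snd v) * N2 (\<pi> q)) + snd (snd v) * N (\<pi> q)))" for q and v :: "real \<times> real \<times> real"
  \<comment> \<open>The \<open>l\<close>-component of the preimage, solved from the second equation;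
    the third is then solved for the \<open>k\<close>-component.\<close>
  define b where "b q v = (fst (snd v) - fst v * Y1 (\<pi> q)) / Y2 (\<pi> q)" for q and v :: "real \<times> real \<times> real"
  define R where "R q v = (fst v, b q v,
      (snd (snd v) - (fst v * M1 (\<pi> q) + b q v * M2 (\<pi> q)) - \<kappa> q * (fst v * N1 (\<pi> q) + b q v * N2 (\<pi> q))) / N (\<pi> q))" for q v
  show ?thesis
  proof (rule smooth_inverse_function[of S \<Psi> "(u0, l0, k0)" L R])
    show "smooth_on S \<Psi>"
      unfolding \<Psi>_def[abs_def] by (intro smooth_on_intros S comp s \<pi>s)
    show "(\<Psi> has_derivative L q) (at q)" if q: "q \<in> S" for q
    proof -
      have "(\<kappa> has_derivative (\<lambda>v. snd (snd v))) (at q)" unfolding \<kappa>_def[abs_def]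
        by (auto intro!: derivative_eq_intros)
      from has_derivative_Pair[OF has_derivative_add[OF has_derivative_const has_derivative_fst[OF has_derivative_ident]]
         has_derivative_Pair[OF D[OF DY(3) q] has_derivative_add[OF D[OF DM(3) q] has_derivative_mult[OF this D[OF DN(3) q]]]]]
      show ?thesis unfolding \<Psi>_def[abs_def] L_def[abs_def] by simp
    qed
    show "R q (L q v) = v" if "q \<in> S" for q v
    proof -
      have "b q (L q v) = fst (snd v)" using \<pi>U[OF that] by (simp add: b_def L_def)
      then show ?thesis using \<pi>U[OF that] by (simp add: R_def prod_eq_iff) (simp add: L_def)
    qed
    show "L q (R q v) = v" if "q \<in> S" for q v
    proof -
      have "fst v * Y1 (\<pi> q) + b q v * Y2 (\<pi> q) = fst (snd v)" using \<pi>U[OF that] by (simp add: b_def)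
      then show ?thesis using \<pi>U[OF that] by (simp add: L_def R_def prod_eq_iff)
    qed
    have bs: "smooth_on S (\<lambda>q. b q v)" for v
      unfolding b_def by (intro smooth_on_intros S comp DY) (use \<pi>U in auto)
    show "smooth_on S (\<lambda>q. R q v)" for v
      unfolding R_def by (intro smooth_on_intros bs S comp DM DN s \<pi>s) (use \<pi>U in auto)
    show "(u0, l0, k0) \<in> S" using U(2) Y2 N by (simp add: S_def U'_def \<pi>_def)
    fix A B g assume "A \<subseteq> S" "(u0, l0, k0) \<in> A" "diffeomorphism A B \<Psi> g"
    moreover have "\<Psi> = (\<lambda>(u, l, k). (c + u, Y (u, l), M (u, l) + k * N (u, l)))"
      by (auto simp: \<Psi>_def \<pi>_def \<kappa>_def)
    moreover have "(u, l) \<in> U" if "(u, l, k) \<in> S" for u l k using \<pi>U(1)[OF that] by (simp add: \<pi>_def)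
    ultimately show ?thesis using that by (metis subsetD)
  qed (rule S)
qed

lemma diffeomorphism_sym: "diffeomorphism U V f g \<Longrightarrow> diffeomorphism V U g f"
  unfolding diffeomorphism_def by (auto intro: homeomorphism_symD)

subsection \<open>Normal form of a tangent developable\<close>

text \<open>The expansion is that of the cut-off function, so it represents \<open>g\<close> only
  where both \<open>t\<close> and \<open>t + w\<close> are near \<open>t0\<close>, while
  \<open>Q\<close> and \<open>P\<close> live on the whole plane.\<close>

lemma smooth_local_expansion:
  fixes g :: "real \<Rightarrow> real"
  assumes "open S" "smooth_on S g" "t0 \<in> S"
  obtains Q P d where "smooth_on UNIV Q" "smooth_on UNIV P" "d > 0"
    "\<And>t w. \<bar>t - t0\<bar> < d \<Longrightarrow> \<bar>t + w - t0\<bar> < d \<Longrightarrow>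
       g (t + w) = g t + w * deriv g t + w\<^sup>2 * Q (t, w\<^sup>2) + w ^ 3 * P (t, w\<^sup>2)"
    "Q (t0, 0) = (deriv ^^ 2) g t0 / 2" "P (t0, 0) = (deriv ^^ 3) g t0 / 6"
proof -
  obtain G d where G: "d > 0" "\<And>n x. (G n has_real_derivative G (Suc n) x) (at x)"
    "\<And>n::nat. \<exists>M. \<forall>x. \<bar>G n x\<bar> \<le> M"
    and eq: "\<And>x n. \<bar>x - t0\<bar> < d \<Longrightarrow> x \<in> S \<and> G n x = (deriv ^^ n) g x"
    by (rule smooth_cutoff[OF assms], rule that)
  obtain Q P where QP: "smooth_on UNIV Q" "smooth_on UNIV P"
    and e: "\<And>x w. G 0 (x + w) = G 0 x + w * G 1 x + w\<^sup>2 * Q (x, w\<^sup>2) + w ^ 3 * P (x, w\<^sup>2)"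
    "\<And>x. Q (x, 0) = G 2 x / 2" "\<And>x. P (x, 0) = G 3 x / 6"
    by (rule smooth_even_odd_expansion[where g = G, OF G(2,3)], rule that)
  have G01: "G 0 t = g t" "G 1 t = deriv g t" if "\<bar>t - t0\<bar> < d" for t
    using eq[OF that, of 0] eq[OF that, of 1] by simp_all
  show ?thesis
  proof (rule that[OF QP G(1)])
    show "g (t + w) = g t + w * deriv g t + w\<^sup>2 * Q (t, w\<^sup>2) + w ^ 3 * P (t, w\<^sup>2)"
      if "\<bar>t - t0\<bar> < d" "\<bar>t + w - t0\<bar> < d" for t w
      using e(1)[of t w] G01[OF that(1)] G01[OF that(2)] by simp
    show "Q (t0, 0) = (deriv ^^ 2) g t0 / 2" "P (t0, 0) = (deriv ^^ 3) g t0 / 6"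
      using eq[of t0] G(1) by (simp_all add: e)
  qed
qed

text \<open>For fixed \<open>s\<close> the plane curve of the last two components satisfies dz = t
  dy and has an ordinary cusp at zeros of \<open>h 2\<close> with \<open>h 3\<close> nonzero. The
  work lies in normalising these cusps smoothly in \<open>s\<close>.\<close>

lemma cuspidal_edge_developable:
  fixes \<xi> \<mu> :: "real \<Rightarrow> real"
  defines "h \<equiv> \<lambda>n x t. (deriv ^^ n) \<xi> t + x * (deriv ^^ n) \<mu> t"
  assumes J: "open J" "smooth_on J \<xi>" "smooth_on J \<mu>" "t0 \<in> J"
    and h2: "h 2 s0 t0 = 0" and h3: "h 3 s0 t0 \<noteq> 0"
    and X: "open X" "(s0, t0) \<in> X"
    and F: "\<And>s t. (s, t) \<in> X \<Longrightarrow> F (s, t) = (s, - h 1 s t, h 0 s t - t * h 1 s t)"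
  shows "cuspidal_edge_at F (s0, t0)"
proof -
  obtain Qa Pa da where a: "smooth_on UNIV Qa" "smooth_on UNIV Pa" "da > 0"
    "\<And>t w. \<bar>t - t0\<bar> < da \<Longrightarrow> \<bar>t + w - t0\<bar> < da \<Longrightarrow>
       deriv \<xi> (t + w) = deriv \<xi> t + w * deriv (deriv \<xi>) t + w\<^sup>2 * Qa (t, w\<^sup>2) + w ^ 3 * Pa (t, w\<^sup>2)"
    "Qa (t0, 0) = (deriv ^^ 2) (deriv \<xi>) t0 / 2"
    using smooth_local_expansion[OF J(1) smooth_on_deriv_smooth[OF J(1,2)] J(4)] by metis
  obtain Qb Pb db where b: "smooth_on UNIV Qb" "smooth_on UNIV Pb" "db > 0"
    "\<And>t w. \<bar>t - t0\<bar> < db \<Longrightarrow> \<bar>t + w - t0\<bar> < db \<Longrightarrow>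
       deriv \<mu> (t + w) = deriv \<mu> t + w * deriv (deriv \<mu>) t + w\<^sup>2 * Qb (t, w\<^sup>2) + w ^ 3 * Pb (t, w\<^sup>2)"
    "Qb (t0, 0) = (deriv ^^ 2) (deriv \<mu>) t0 / 2"
    using smooth_local_expansion[OF J(1) smooth_on_deriv_smooth[OF J(1,3)] J(4)] by metis
  obtain qa pa ea where a': "smooth_on UNIV qa" "smooth_on UNIV pa" "ea > 0"
    "\<And>t w. \<bar>t - t0\<bar> < ea \<Longrightarrow> \<bar>t + w - t0\<bar> < ea \<Longrightarrow>
       \<xi> (t + w) = \<xi> t + w * deriv \<xi> t + w\<^sup>2 * qa (t, w\<^sup>2) + w ^ 3 * pa (t, w\<^sup>2)"
    "pa (t0, 0) = (deriv ^^ 3) \<xi> t0 / 6"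
    using smooth_local_expansion[OF J(1,2,4)] by metis
  obtain qb pb eb where b': "smooth_on UNIV qb" "smooth_on UNIV pb" "eb > 0"
    "\<And>t w. \<bar>t - t0\<bar> < eb \<Longrightarrow> \<bar>t + w - t0\<bar> < eb \<Longrightarrow>
       \<mu> (t + w) = \<mu> t + w * deriv \<mu> t + w\<^sup>2 * qb (t, w\<^sup>2) + w ^ 3 * pb (t, w\<^sup>2)"
    "pb (t0, 0) = (deriv ^^ 3) \<mu> t0 / 6"
    using smooth_local_expansion[OF J(1,3,4)] by metis
  obtain dj where dj: "dj > 0" "ball t0 dj \<subseteq> J" using J(1,4) openE by blast
  define d where "d = Min {da, db, ea, eb, dj}"
  have d: "d > 0" "d \<le> da" "d \<le> db" "d \<le> ea" "d \<le> eb" "d \<le> dj"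
    using a(3) b(3) a'(3) b'(3) dj(1) by (auto simp: d_def)
  define I where "I = ball t0 d"
  have I: "open I" "t0 \<in> I" "I \<subseteq> J" using d dj(2) by (auto simp: I_def)
  have h_s: "smooth_on S (\<lambda>q. h n (f q) (g q))"
    if "open S" "smooth_on S f" "smooth_on S g" "\<And>q. q \<in> S \<Longrightarrow> g q \<in> J" for n S and f g :: "'x::euclidean_space \<Rightarrow> real"
    unfolding h_def
    by (intro smooth_on_add smooth_on_mult that(1,2) smooth_on_compose[OF that(1) J(1) smooth_on_deriv_funpow[OF J(1) J(2)] that(3,4)]
        smooth_on_compose[OF that(1) J(1) smooth_on_deriv_funpow[OF J(1) J(3)] that(3,4)])
  have h_d: "(h n x has_real_derivative h (Suc n) x t) (at t)" if "t \<in> J" for n x t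
    using smooth_on_deriv[OF smooth_on_deriv_funpow[OF J(1,2)] that] smooth_on_deriv[OF smooth_on_deriv_funpow[OF J(1,3)] that]
    unfolding h_def by (auto intro!: derivative_eq_intros)
  \<comment> \<open>As \<open>h\<close> is affine in its first argument, its expansion coefficients
    combine those of \<xi> and \<mu>; here \<open>fst q\<close> is the displacement from
    \<open>s0\<close> and \<open>snd q\<close> stands for the square of \<open>w\<close>.\<close>
  define comb where "comb f g q t = f (t, snd q) + (s0 + fst q) * g (t, snd q)" for f g :: "real \<times> real \<Rightarrow> real" and q t
  have comb_s: "smooth_on S (\<lambda>q. comb f g (\<beta> q) (\<tau> q))"
    if "open S" "smooth_on UNIV f" "smooth_on UNIV g" "smooth_on S \<beta>" "smooth_on S \<tau>"
    for S f g and \<beta> :: "'x::euclidean_space \<Rightarrow> real \<times> real" and \<tau>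
    unfolding comb_def
    by (intro smooth_on_intros that smooth_on_compose[OF that(1) _ that(2)] smooth_on_compose[OF that(1) _ that(3)]) auto
  have exp1: "h 1 (s0 + u) (t + w) = h 1 (s0 + u) t + w * h 2 (s0 + u) t + w\<^sup>2 * comb Qa Qb (u, w\<^sup>2) t + w ^ 3 * comb Pa Pb (u, w\<^sup>2) t"
    and exp0: "h 0 (s0 + u) (t + w) = h 0 (s0 + u) t + w * h 1 (s0 + u) t + w\<^sup>2 * comb qa qb (u, w\<^sup>2) t + w ^ 3 * comb pa pb (u, w\<^sup>2) t"
    if "t \<in> I" "t + w \<in> I" for t w u
  proof -
    have t: "\<bar>t - t0\<bar> < d" "\<bar>t + w - t0\<bar> < d" using that by (auto simp: I_def dist_real_def)
    show "h 1 (s0 + u) (t + w) = h 1 (s0 + u) t + w * h 2 (s0 + u) t + w\<^sup>2 * comb Qa Qb (u, w\<^sup>2) t + w ^ 3 * comb Pa Pb (u, w\<^sup>2) t"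
      using a(4)[of t w] b(4)[of t w] t d by (simp add: h_def comb_def numeral_2_eq_2 algebra_simps)
    show "h 0 (s0 + u) (t + w) = h 0 (s0 + u) t + w * h 1 (s0 + u) t + w\<^sup>2 * comb qa qb (u, w\<^sup>2) t + w ^ 3 * comb pa pb (u, w\<^sup>2) t"
      using a'(4)[of t w] b'(4)[of t w] t d by (simp add: h_def comb_def algebra_simps)
  qed
  \<comment> \<open>The odd part of \<open>w \<mapsto> h 1 (s0 + u) (\<sigma> + w)\<close>, divided by \<open>w\<close>, at \<open>w\<^sup>2 = l\<close>, for \<open>q = ((u, l), \<sigma>)\<close>.
    Solving \<open>B = 0\<close> for \<open>\<sigma>\<close> makes the second component of \<open>F\<close> even in \<open>w\<close>.\<close>
  define B where "B q = h 2 (s0 + fst (fst q)) (snd q) + snd (fst q) * comb Pa Pb (fst q) (snd q)" for q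
  have S3: "open (UNIV \<times> I)" "((0, 0), t0) \<in> (UNIV :: (real \<times> real) set) \<times> I" using I by (auto intro: open_Times)
  have B_s: "smooth_on (UNIV \<times> I) B" unfolding B_def[abs_def]
    by (intro smooth_on_intros h_s comb_s S3(1) a b) (use I in auto)
  have B0: "B ((0, 0), t) = h 2 s0 t" for t by (simp add: B_def)
  \<comment> \<open>At \<open>l = 0\<close> the function \<open>B\<close> is \<open>h 2\<close>, so
    \<open>h 3\<close> being nonzero is exactly the condition for solving for \<sigma>.\<close>
  have "((\<lambda>t. B ((0, 0), t)) has_real_derivative h 3 s0 t0) (at t0)"
    unfolding B0 using h_d[OF J(4), of 2 s0] by (simp add: numeral_3_eq_3 numeral_2_eq_2)
  then have "frechet_derivative B (at ((0, 0), t0)) (0, 1) \<noteq> 0"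
    using DERIV_partial_snd[OF B_s S3(2)] h3 DERIV_unique by metis
  then obtain U \<sigma> where U: "open U" "(0, 0) \<in> U" and \<sigma>: "smooth_on U \<sigma>" "\<sigma> (0, 0) = t0"
    and \<sigma>B: "\<And>p. p \<in> U \<Longrightarrow> \<sigma> p \<in> I \<and> B (p, \<sigma> p) = 0"
    using implicit_function_smooth[OF S3(1) B_s S3(2)] B0[of t0] h2 by (metis mem_Sigma_iff)
  have \<sigma>J: "\<sigma> p \<in> J" if "p \<in> U" for p using \<sigma>B[OF that] I by auto
  \<comment> \<open>Substituting \<sigma> + w for t: \<open>Y\<close> is the second component, now
    even in \<open>w\<close>; \<open>M\<close> is the even part of the third, and \<open>N\<close>
    its odd part divided by w^3. The term linear in \<open>w\<close> cancels there, leaving the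
    difference of coefficients in \<open>N\<close>.\<close>
  define Y where "Y p = - (h 1 (s0 + fst p) (\<sigma> p) + snd p * comb Qa Qb p (\<sigma> p))" for p
  define M where "M p = h 0 (s0 + fst p) (\<sigma> p) + snd p * comb qa qb p (\<sigma> p) + \<sigma> p * Y p" for p
  define N where "N p = comb pa pb p (\<sigma> p) - comb Qa Qb p (\<sigma> p)" for p
  have Q0: "comb Qa Qb (0, 0) t0 = h 3 s0 t0 / 2"
    by (simp add: comb_def a(5) b(5) h_def numeral_3_eq_3 numeral_2_eq_2 field_simps)
  have p0: "comb pa pb (0, 0) t0 = h 3 s0 t0 / 6"
    by (simp add: comb_def a'(5) b'(5) h_def field_simps)
  have Y_s: "smooth_on U Y" unfolding Y_def[abs_def]
    by (intro smooth_on_intros h_s comb_s U a b \<sigma>) (use \<sigma>J in auto)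
  have M_s: "smooth_on U M" unfolding M_def[abs_def]
    by (intro smooth_on_intros h_s comb_s U a' b' \<sigma> Y_s) (use \<sigma>J in auto)
  have N_s: "smooth_on U N" unfolding N_def[abs_def]
    by (intro smooth_on_intros comb_s U a b a' b' \<sigma>)
  have N0: "N (0, 0) \<noteq> 0" using h3 by (simp add: N_def \<sigma>(2) Q0 p0)
  \<comment> \<open>The variation of \<sigma> enters only through \<open>h 2\<close>, which is zero
    here; what remains is the quadratic coefficient \<open>h 3 s0 t0 / 2\<close>.\<close>
  have Y': "((\<lambda>l. Y (0, l)) has_real_derivative - (h 3 s0 t0 / 2)) (at 0)"
  proof -
    obtain \<sigma>' where 1: "((\<lambda>l. \<sigma> (0, l)) has_real_derivative \<sigma>') (at 0)"
      using DERIV_partial_snd[OF \<sigma>(1) U(2)] by blast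
    have "smooth_on U (\<lambda>p. comb Qa Qb p (\<sigma> p))" by (intro smooth_on_intros comb_s U a b \<sigma>)
    from DERIV_partial_snd[OF this U(2)] obtain q' where
      2: "((\<lambda>l. comb Qa Qb (0, l) (\<sigma> (0, l))) has_real_derivative q') (at 0)" by blast
    have "((\<lambda>l. h 1 s0 (\<sigma> (0, l))) has_real_derivative h (Suc 1) s0 (\<sigma> (0, 0)) * \<sigma>') (at 0)"
      by (rule DERIV_chain2[OF h_d 1]) (simp add: \<sigma>(2) J)
    then have "((\<lambda>l. h 1 s0 (\<sigma> (0, l))) has_real_derivative 0) (at 0)"
      using h2 by (simp add: \<sigma>(2) numeral_2_eq_2)
    from DERIV_minus[OF DERIV_add[OF this DERIV_mult[OF DERIV_ident 2]]]
    show ?thesis unfolding Y_def by (simp add: \<sigma>(2) Q0)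
  qed
  have nz: "- (h 3 s0 t0 / 2) \<noteq> 0" using h3 by simp
  obtain A A' \<Psi>' where A: "(0, 0, 0) \<in> A" "\<And>u l k. (u, l, k) \<in> A \<Longrightarrow> (u, l) \<in> U"
    and \<Psi>: "diffeomorphism A A' (\<lambda>(u, l, k). (s0 + u, Y (u, l), M (u, l) + k * N (u, l))) \<Psi>'"
    by (rule space_local_diffeomorphism[OF U Y_s M_s N_s Y' nz N0], rule that)
  define \<Psi> where "\<Psi> = (\<lambda>(u, l, k). (s0 + u, Y (u, l), M (u, l) + k * N (u, l)))"
  define S0 where "S0 = {q::real \<times> real. (fst q, (snd q)\<^sup>2) \<in> U}"
  define \<tau> where "\<tau> q = \<sigma> (fst q, (snd q)\<^sup>2) + snd q" for q
  define T where "T q = (s0 + fst q, \<tau> q)" for q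
  have S0: "open S0" "(0, 0) \<in> S0"
  proof -
    have "continuous_on UNIV (\<lambda>q::real \<times> real. (fst q, (snd q)\<^sup>2))" by (intro continuous_intros)
    from open_vimage_Int[OF open_UNIV this U(1)] show "open S0" by (simp add: S0_def)
  qed (use U(2) in \<open>simp add: S0_def\<close>)
  have \<tau>_s: "smooth_on S0 \<tau>" unfolding \<tau>_def[abs_def]
    by (intro smooth_on_intros S0 smooth_on_compose[OF S0(1) U(1) \<sigma>(1)]) (simp add: S0_def)
  have A_open: "open A" using \<Psi> by (simp add: diffeomorphism_def)
  define S2 where "S2 = {q \<in> S0. ((fst q, (snd q)\<^sup>2, (snd q) ^ 3), \<tau> q, T q) \<in> A \<times> I \<times> X}"
  have S2: "open S2" "S2 \<subseteq> S0" "(0, 0) \<in> S2"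
  proof -
    have "continuous_on S0 \<tau>" by (rule smooth_on_imp_continuous_on[OF \<tau>_s])
    then have "continuous_on S0 (\<lambda>q. ((fst q, (snd q)\<^sup>2, (snd q) ^ 3), \<tau> q, T q))"
      unfolding T_def by (intro continuous_intros)
    then show "open S2"
      unfolding S2_def by (intro open_vimage_Int S0 open_Times A_open I X)
    show "S2 \<subseteq> S0" by (auto simp: S2_def)
    show "(0, 0) \<in> S2" using S0(2) A(1) I(2) X(2) by (simp add: S2_def \<tau>_def T_def \<sigma>(2))
  qed
  \<comment> \<open>Since \<sigma> depends on the square of \<open>w\<close>, it contributes nothing
    at \<open>w = 0\<close>, and \<open>T\<close> is a local change of source coordinates.\<close>
  have "((\<lambda>w. \<tau> (0, w)) has_real_derivative 1) (at 0)"
  proof -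
    obtain \<sigma>' where 1: "((\<lambda>l. \<sigma> (0, l)) has_real_derivative \<sigma>') (at (0\<^sup>2))"
      using DERIV_partial_snd[OF \<sigma>(1) U(2)] by auto
    have "((\<lambda>w::real. w\<^sup>2) has_real_derivative 0) (at 0)" by (auto intro!: derivative_eq_intros)
    from DERIV_add[OF DERIV_chain2[OF 1 this] DERIV_ident] show ?thesis by (simp add: \<tau>_def)
  qed
  then have "frechet_derivative \<tau> (at (0, 0)) (0, 1) \<noteq> 0"
    using DERIV_partial_snd[OF \<tau>_s S0(2)] DERIV_unique by fastforce
  then obtain U2 V2 g where U2: "U2 \<subseteq> S2" "(0, 0) \<in> U2" "diffeomorphism U2 V2 T g"
    using triangular_local_diffeomorphism[OF S2(1) smooth_on_subset[OF \<tau>_s S2(2)] S2(3)] unfolding T_def[abs_def] by metis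
  have key: "F (T q) = \<Psi> (fst q, (snd q)\<^sup>2, (snd q) ^ 3)" if q: "q \<in> S2" for q
  proof -
    obtain u w where uw: "q = (u, w)" by force
    define t where "t = \<sigma> (u, w\<^sup>2)"
    have m: "(u, w\<^sup>2) \<in> U" "t + w \<in> I" "(s0 + u, t + w) \<in> X"
      using q by (auto simp: S2_def S0_def uw \<tau>_def T_def t_def)
    have t: "t \<in> I" "B ((u, w\<^sup>2), t) = 0" using \<sigma>B[OF m(1)] by (auto simp: t_def)
    have B': "h 2 (s0 + u) t = - (w\<^sup>2 * comb Pa Pb (u, w\<^sup>2) t)" using t(2) by (simp add: B_def)
    have Yt: "Y (u, w\<^sup>2) = - (h 1 (s0 + u) t + w\<^sup>2 * comb Qa Qb (u, w\<^sup>2) t)" by (simp add: Y_def t_def)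
    \<comment> \<open>The equation \<open>B = 0\<close> makes the terms in w and w^3 cancel.\<close>
    have h1: "h 1 (s0 + u) (t + w) = - Y (u, w\<^sup>2)"
      unfolding exp1[OF t(1) m(2)] B' Yt by (simp add: power2_eq_square power3_eq_cube)
    have h1t: "h 1 (s0 + u) t = - Y (u, w\<^sup>2) - w\<^sup>2 * comb Qa Qb (u, w\<^sup>2) t" using Yt by simp
    have Mt: "M (u, w\<^sup>2) = h 0 (s0 + u) t + w\<^sup>2 * comb qa qb (u, w\<^sup>2) t + t * Y (u, w\<^sup>2)"
      and Nt: "N (u, w\<^sup>2) = comb pa pb (u, w\<^sup>2) t - comb Qa Qb (u, w\<^sup>2) t"
      by (simp_all add: M_def N_def t_def)
    have "h 0 (s0 + u) (t + w) - (t + w) * h 1 (s0 + u) (t + w) = M (u, w\<^sup>2) + w ^ 3 * N (u, w\<^sup>2)"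
      unfolding h1 exp0[OF t(1) m(2)] h1t Mt Nt
      by (simp add: algebra_simps power2_eq_square power3_eq_cube)
    then show ?thesis using F[OF m(3)] h1 by (simp add: uw T_def \<tau>_def t_def[symmetric] \<Psi>_def)
  qed
  have hT: "homeomorphism U2 V2 T g" using U2(3) by (simp add: diffeomorphism_def)
  have h\<Psi>: "homeomorphism A A' \<Psi> \<Psi>'" using \<Psi> by (simp add: diffeomorphism_def \<Psi>_def)
  have inA: "(fst q, (snd q)\<^sup>2, (snd q) ^ 3) \<in> A" if "q \<in> U2" for q using U2(1) that by (auto simp: S2_def)
  have T0: "T (0, 0) = (s0, t0)" by (simp add: T_def \<tau>_def \<sigma>(2))
  have on_V2: "F x \<in> A' \<and> \<Psi>' (F x) = (case g x of (u, v) \<Rightarrow> (u, v\<^sup>2, v ^ 3))" if "x \<in> V2" for x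
  proof -
    have x: "g x \<in> U2" "T (g x) = x" using hT that unfolding homeomorphism_def by blast+
    then have "F x = \<Psi> (fst (g x), (snd (g x))\<^sup>2, (snd (g x)) ^ 3)" using key[of "g x"] U2(1) by auto
    then show ?thesis using inA[OF x(1)] h\<Psi> unfolding homeomorphism_def by (auto simp: split_beta)
  qed
  have a0: "(s0, t0) \<in> V2" "g (s0, t0) = (0, 0)"
    using hT U2(2) T0 unfolding homeomorphism_def by (metis imageI)+
  \<comment> \<open>The coordinate changes found so far lead from the normal form to
    \<open>F\<close>; the equivalence asks for the opposite direction, so their inverses are the
    witnesses.\<close>
  show ?thesis
    unfolding cuspidal_edge_at_def right_left_equivalent_def
  proof (intro exI conjI)
    show "diffeomorphism V2 U2 g T" by (rule diffeomorphism_sym[OF U2(3)])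
    show "diffeomorphism A' A \<Psi>' \<Psi>" unfolding \<Psi>_def by (rule diffeomorphism_sym[OF \<Psi>])
    show "\<Psi>' (F (s0, t0)) = (case (0, 0) of (u, v) \<Rightarrow> (u, v\<^sup>2, v ^ 3))"
      using on_V2[OF a0(1)] a0(2) by simp
    show "\<forall>x\<in>V2. \<Psi>' (F x) = (case g x of (u, v) \<Rightarrow> (u, v\<^sup>2, v ^ 3))" using on_V2 by blast
  qed (use a0 on_V2 in auto)
qed

subsection \<open>The integral manifold\<close>

lemma smooth_curve_derivative:
  fixes f :: "'a::euclidean_space \<Rightarrow> real"
  assumes "smooth_on S f" "c t \<in> S" "(c has_vector_derivative v) (at t)"
  shows "((\<lambda>t. f (c t)) has_real_derivative frechet_derivative f (at (c t)) v) (at t)"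
proof -
  have "(f has_derivative frechet_derivative f (at (c t))) (at (c t) within range c)"
    using smooth_on_derivative[OF assms(1,2)] has_derivative_at_withinI by blast
  from vector_derivative_diff_chain_within[OF assms(3) this] show ?thesis
    by (simp add: o_def has_real_derivative_iff_has_vector_derivative)
qed

lemma jet_partial_derivatives:
  assumes "smooth_on D \<alpha>" "(x, y, z, p, q) \<in> D"
  shows "D_x \<alpha> (x, y, z, p, q) = frechet_derivative \<alpha> (at (x, y, z, p, q)) (1, 0, 0, 0, 0)"
    and "D_y \<alpha> (x, y, z, p, q) = frechet_derivative \<alpha> (at (x, y, z, p, q)) (0, 1, 0, 0, 0)"
    and "D_z \<alpha> (x, y, z, p, q) = frechet_derivative \<alpha> (at (x, y, z, p, q)) (0, 0, 1, 0, 0)"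
    and "D_p \<alpha> (x, y, z, p, q) = frechet_derivative \<alpha> (at (x, y, z, p, q)) (0, 0, 0, 1, 0)"
    and "D_q \<alpha> (x, y, z, p, q) = frechet_derivative \<alpha> (at (x, y, z, p, q)) (0, 0, 0, 0, 1)"
proof -
  note v = has_vector_derivative_Pair has_vector_derivative_const has_vector_derivative_id
  note c = smooth_curve_derivative[OF assms(1) _, THEN DERIV_imp_deriv]
  have 1: "((\<lambda>r. (r, y, z, p, q)) has_vector_derivative (1, 0, 0, 0, 0)) (at x)"
    and 2: "((\<lambda>r. (x, r, z, p, q)) has_vector_derivative (0, 1, 0, 0, 0)) (at y)"
    and 3: "((\<lambda>r. (x, y, r, p, q)) has_vector_derivative (0, 0, 1, 0, 0)) (at z)"
    and 4: "((\<lambda>r. (x, y, z, r, q)) has_vector_derivative (0, 0, 0, 1, 0)) (at p)"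
    and 5: "((\<lambda>r. (x, y, z, p, r)) has_vector_derivative (0, 0, 0, 0, 1)) (at q)"
    by (intro v)+
  show "D_x \<alpha> (x, y, z, p, q) = frechet_derivative \<alpha> (at (x, y, z, p, q)) (1, 0, 0, 0, 0)"
    using c[OF _ 1] assms(2) by simp
  show "D_y \<alpha> (x, y, z, p, q) = frechet_derivative \<alpha> (at (x, y, z, p, q)) (0, 1, 0, 0, 0)"
    using c[OF _ 2] assms(2) by simp
  show "D_z \<alpha> (x, y, z, p, q) = frechet_derivative \<alpha> (at (x, y, z, p, q)) (0, 0, 1, 0, 0)"
    using c[OF _ 3] assms(2) by simp
  show "D_p \<alpha> (x, y, z, p, q) = frechet_derivative \<alpha> (at (x, y, z, p, q)) (0, 0, 0, 1, 0)"
    using c[OF _ 4] assms(2) by simp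
  show "D_q \<alpha> (x, y, z, p, q) = frechet_derivative \<alpha> (at (x, y, z, p, q)) (0, 0, 0, 0, 1)"
    using c[OF _ 5] assms(2) by simp
qed

declare D_x.simps [simp del] D_y.simps [simp del] D_z.simps [simp del] D_p.simps [simp del] D_q.simps [simp del]

lemma DERIV_jet:
  assumes "smooth_on D \<alpha>" "(X t, Y t, Z t, P t, Q t) \<in> D"
    and "(X has_real_derivative x) (at t)" "(Y has_real_derivative y) (at t)" "(Z has_real_derivative z) (at t)"
    "(P has_real_derivative p) (at t)" "(Q has_real_derivative q) (at t)"
  shows "((\<lambda>t. \<alpha> (X t, Y t, Z t, P t, Q t)) has_real_derivative
    x * D_x \<alpha> (X t, Y t, Z t, P t, Q t) + y * D_y \<alpha> (X t, Y t, Z t, P t, Q t) + z * D_z \<alpha> (X t, Y t, Z t, P t, Q t)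
    + p * D_p \<alpha> (X t, Y t, Z t, P t, Q t) + q * D_q \<alpha> (X t, Y t, Z t, P t, Q t)) (at t)"
proof -
  let ?c = "\<lambda>t. (X t, Y t, Z t, P t, Q t)"
  let ?d = "frechet_derivative \<alpha> (at (?c t))"
  have "((\<lambda>t. \<alpha> (?c t)) has_real_derivative ?d (x, y, z, p, q)) (at t)"
    using assms(3-7) by (intro smooth_curve_derivative[where c = ?c, OF assms(1,2)] has_vector_derivative_Pair)
      (simp_all add: has_real_derivative_iff_has_vector_derivative)
  moreover have "?d (x, y, z, p, q) = x * D_x \<alpha> (?c t) + y * D_y \<alpha> (?c t) + z * D_z \<alpha> (?c t) + p * D_p \<alpha> (?c t) + q * D_q \<alpha> (?c t)"
  proof -
    have l: "linear ?d" using has_derivative_linear[OF smooth_on_derivative[OF assms(1,2)]] .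
    have "?d (x, y, z, p, q) = ?d (x *\<^sub>R (1, 0, 0, 0, 0) + y *\<^sub>R (0, 1, 0, 0, 0) + z *\<^sub>R (0, 0, 1, 0, 0)
        + p *\<^sub>R (0, 0, 0, 1, 0) + q *\<^sub>R (0, 0, 0, 0, 1))" by simp
    then show ?thesis
      by (simp only: linear_add[OF l] linear_cmul[OF l] jet_partial_derivatives[OF assms(1,2)] real_scaleR_def)
  qed
  ultimately show ?thesis by simp
qed

text \<open>\<open>Phi1\<close> keeps x, p and q, and the other two equations are linear in y and z
  once the value \<open>a\<close> of \<alpha> is named. The description is implicit, because
  \<open>a\<close> is taken at the very point described.\<close>

lemma local_inverse_Phi1_point:
  assumes "local_inverse_Phi1 D \<alpha> K U G" "x \<in> K" "(u1, u2, u3, u4) \<in> U"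
  defines "a \<equiv> \<alpha> (G (x, u1, u2, u3, u4))"
  shows "G (x, u1, u2, u3, u4) = (x, u1 - a * x, u2 + u3 * x + u4 * (u1 - a * x), u3, u4)"
    and "G (x, u1, u2, u3, u4) \<in> D"
proof -
  obtain W where W: "W \<subseteq> D" "diffeomorphism W (K \<times> U) (Phi1 \<alpha>) G"
    using assms(1) by (auto simp: local_inverse_Phi1_def)
  then have G: "Phi1 \<alpha> (G (x, u1, u2, u3, u4)) = (x, u1, u2, u3, u4)" "G (x, u1, u2, u3, u4) \<in> W"
    using assms(2,3) unfolding diffeomorphism_def homeomorphism_def by (metis SigmaI imageI)+
  show "G (x, u1, u2, u3, u4) \<in> D" using G(2) W(1) by blast
  obtain y0 y z p q where e: "G (x, u1, u2, u3, u4) = (y0, y, z, p, q)" by (metis prod_cases5)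
  show "G (x, u1, u2, u3, u4) = (x, u1 - a * x, u2 + u3 * x + u4 * (u1 - a * x), u3, u4)"
    using G(1) unfolding a_def e by (auto simp: algebra_simps)
qed

text \<open>Differentiating \<open>A x = \<alpha> (G (x, u))\<close> along the line, the involutive
  equation removes all terms without \<open>A'\<close> on the right and leaves
  \<open>A' * (1 + x * (\<alpha>\<^sub>y + q * \<alpha>\<^sub>z)) = 0\<close>. Genericity gives
  \<open>A' = 0\<close>, and \<open>K\<close> is an interval.\<close>

lemma alpha_bar_eq:
  assumes D: "smooth_on D \<alpha>" "open D" and inv: "involutive_type D \<alpha>" "generic_type D \<alpha>"
    and G: "local_inverse_Phi1 D \<alpha> K U G" and x: "x \<in> K" and u: "u \<in> U"
  shows "alpha_bar \<alpha> K G u = \<alpha> (G (x, u))"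
proof -
  obtain u1 u2 u3 u4 where ue: "u = (u1, u2, u3, u4)" by (metis prod_cases4)
  define A where "A x = \<alpha> (G (x, u))" for x
  define Y where "Y x = u1 - A x * x" for x
  define Z where "Z x = u2 + u3 * x + u4 * Y x" for x
  have Gx: "G (x, u) = (x, Y x, Z x, u3, u4)" "G (x, u) \<in> D" if "x \<in> K" for x
    using local_inverse_Phi1_point[OF G that u[unfolded ue]] by (simp_all add: ue A_def Y_def Z_def)
  have K: "open K" "convex K" using G by (auto simp: local_inverse_Phi1_def is_interval_convex)
  have Gs: "smooth_on (K \<times> U) G" "open (K \<times> U)" using G by (auto simp: local_inverse_Phi1_def diffeomorphism_def)
  have "smooth_on K A" unfolding A_def
    by (rule smooth_on_compose[OF K(1) D(2,1)],
        rule smooth_on_compose[OF K(1) Gs(2,1)])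
       (use K u Gx(2) in \<open>auto intro!: smooth_on_intros\<close>)
  then have dA: "(A has_real_derivative deriv A x) (at x)" if "x \<in> K" for x
    using smooth_on_deriv that by blast
  have "(A has_real_derivative 0) (at x)" if x: "x \<in> K" for x
  proof -
    define A' where "A' = deriv A x"
    define Y' where "Y' = - (A' * x + A x)"
    have 1: "(A has_real_derivative A') (at x)" using dA[OF x] by (simp add: A'_def)
    have Y': "(Y has_real_derivative Y') (at x)"
      unfolding Y_def[abs_def] Y'_def by (auto intro!: derivative_eq_intros 1 simp: algebra_simps)
    have Z': "(Z has_real_derivative u3 + u4 * Y') (at x)"
      unfolding Z_def[abs_def] by (auto intro!: derivative_eq_intros Y')
    let ?P = "(x, Y x, Z x, u3, u4)"
    have P: "?P \<in> D" using Gx[OF x] by simp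
    have "((\<lambda>x. \<alpha> (x, Y x, Z x, u3, u4)) has_real_derivative
        1 * D_x \<alpha> ?P + Y' * D_y \<alpha> ?P + (u3 + u4 * Y') * D_z \<alpha> ?P + 0 * D_p \<alpha> ?P + 0 * D_q \<alpha> ?P) (at x)"
      by (rule DERIV_jet[OF D(1)]) (use P Y' Z' in auto)
    then have "((\<lambda>x. \<alpha> (x, Y x, Z x, u3, u4)) has_real_derivative D_x \<alpha> ?P + Y' * D_y \<alpha> ?P + (u3 + u4 * Y') * D_z \<alpha> ?P) (at x)"
      by simp
    then have "(A has_real_derivative D_x \<alpha> ?P + Y' * D_y \<alpha> ?P + (u3 + u4 * Y') * D_z \<alpha> ?P) (at x)"
      by (rule has_field_derivative_transform_within_open[OF _ K(1) x]) (use Gx in \<open>simp add: A_def\<close>)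
    then have "A' = D_x \<alpha> ?P + Y' * D_y \<alpha> ?P + (u3 + u4 * Y') * D_z \<alpha> ?P" using 1 DERIV_unique by blast
    moreover have "D_x \<alpha> ?P + u3 * D_z \<alpha> ?P - A x * (D_y \<alpha> ?P + u4 * D_z \<alpha> ?P) = 0"
      using inv(1) P Gx(1)[OF x] unfolding involutive_type_def Let_def A_def by fastforce
    moreover have "1 + x * (D_y \<alpha> ?P + u4 * D_z \<alpha> ?P) \<noteq> 0"
      using inv(2) P unfolding generic_type_def Let_def by fastforce
    moreover have "D_x \<alpha> ?P + Y' * D_y \<alpha> ?P + (u3 + u4 * Y') * D_z \<alpha> ?P
        = D_x \<alpha> ?P + u3 * D_z \<alpha> ?P - A x * (D_y \<alpha> ?P + u4 * D_z \<alpha> ?P) - A' * (x * (D_y \<alpha> ?P + u4 * D_z \<alpha> ?P))"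
      by (simp add: Y'_def algebra_simps)
    ultimately have "A' * (1 + x * (D_y \<alpha> ?P + u4 * D_z \<alpha> ?P)) = 0" by (simp add: distrib_left)
    then have "A' = 0" using \<open>1 + x * (D_y \<alpha> ?P + u4 * D_z \<alpha> ?P) \<noteq> 0\<close> by simp
    then show ?thesis using 1 by simp
  qed
  then have "\<exists>c. \<forall>x\<in>K. A x = c"
    by (intro has_field_derivative_zero_constant[OF K(2)]) (auto intro: has_field_derivative_at_within)
  then obtain c where c: "\<forall>x\<in>K. A x = c" by (rule exE)
  have "\<alpha> (G (x', u)) = \<alpha> (G (x, u))" if "x' \<in> K" for x'
    using bspec[OF c that] bspec[OF c x] by (simp only: A_def)
  \<comment> \<open>The given point of \<open>K\<close> makes the slice nonempty, which is what
    makes the described constant unique.\<close>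
  then show ?thesis unfolding alpha_bar_def by (intro the_equality) (blast, drule bspec[OF _ x], rule sym)
qed

text \<open>The first component confines the kernel of the derivative to the t-direction, where the
  second acts by \<open>d\<close>; a nonzero \<open>d\<close> would make the derivative injective,
  of rank two.\<close>

lemma developable_singular:
  fixes F :: "real \<times> real \<Rightarrow> real \<times> real \<times> real"
  assumes X: "open X" "(s0, t0) \<in> X" and "smooth_on X F"
    and F: "\<And>q. q \<in> X \<Longrightarrow> fst (F q) = fst q"
    and d: "((\<lambda>t. fst (snd (F (s0, t)))) has_real_derivative d) (at t0)"
    and sing: "dim (range (frechet_derivative F (at (s0, t0)))) < 2"
  shows "d = 0"
proof (rule ccontr)
  assume "d \<noteq> 0"
  let ?D = "frechet_derivative F (at (s0, t0))"
  have D: "(F has_derivative ?D) (at (s0, t0))" by (rule smooth_on_derivative[OF assms(3) X(2)])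
  have l: "linear ?D" by (rule has_derivative_linear[OF D])
  have "((\<lambda>q. fst (F q)) has_derivative (\<lambda>v. fst (?D v))) (at (s0, t0))"
    by (rule has_derivative_fst[OF D])
  then have "((\<lambda>q. fst q) has_derivative (\<lambda>v. fst (?D v))) (at (s0, t0))"
    by (rule has_derivative_transform_within_open[OF _ X]) (rule F)
  moreover have "((\<lambda>q. fst q) has_derivative (\<lambda>v. fst v)) (at (s0, t0))"
    by (rule has_derivative_fst[OF has_derivative_ident])
  ultimately have f: "fst (?D v) = fst v" for v by (metis has_derivative_unique)
  have "((\<lambda>q. fst (snd (F q))) has_derivative (\<lambda>v. fst (snd (?D v)))) (at (s0, t0))"
    by (rule has_derivative_fst[OF has_derivative_snd[OF D]])
  moreover have "((\<lambda>t. (s0, t)) has_derivative (\<lambda>h. (0, h))) (at t0)"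
    by (intro has_derivative_Pair has_derivative_const has_derivative_ident)
  ultimately have "((\<lambda>t. fst (snd (F (s0, t)))) has_derivative (\<lambda>h. fst (snd (?D (0, h))))) (at t0)"
    using diff_chain_at[of "\<lambda>t. (s0, t)"] by (fastforce simp: o_def)
  then have s: "fst (snd (?D (0, h))) = d * h" for h
    using d unfolding has_field_derivative_def by (metis has_derivative_unique)
  have "v = 0" if "?D v = 0" for v
  proof -
    have "fst v = 0" using f[of v] that by simp
    then have v: "v = (0, snd v)" by (simp add: prod_eq_iff)
    then have "d * snd v = 0" using s[of "snd v"] that by (metis fst_zero snd_zero)
    then show ?thesis using v \<open>d \<noteq> 0\<close> by (simp add: prod_eq_iff)
  qed
  then have "inj ?D" using linear_injective_0[OF l] by blast
  then have "dim (range ?D) = dim (UNIV :: (real \<times> real) set)"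
    by (intro dim_image_eq l) auto
  then show False using sing by (simp add: dim_UNIV)
qed

section \<open>From the condition on the integral manifold to the third derivative of
  \<open>h\<close>\<close>

theorem theorem6p24:
  fixes \<alpha> :: "jet \<Rightarrow> real" and D :: "jet set"
    and K :: "real set" and U1 :: "real4 set"
    and G :: "real \<times> real4 \<Rightarrow> jet"
    and \<xi> \<mu> :: "real \<Rightarrow> real" and I1 J1 :: "real set" and s0 t0 :: real
  assumes "open D" and "smooth_on D \<alpha>"
    and "involutive_type D \<alpha>" and "generic_type D \<alpha>"
    and "local_inverse_Phi1 D \<alpha> K U1 G"
    and "open I1" and "is_interval I1" and "open J1" and "is_interval J1"
    and "smooth_on J1 \<xi>" and "smooth_on J1 \<mu>"
    and "\<And>s t. s \<in> I1 \<Longrightarrow> t \<in> J1 \<Longrightarrow> (s, - deriv \<xi> t, \<xi> t, \<mu> t, t) \<in> K \<times> U1"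
    and "\<And>t. t \<in> J1 \<Longrightarrow>
           (\<mu> has_real_derivative alpha_bar \<alpha> K G (- deriv \<xi> t, \<xi> t, \<mu> t, t)) (at t)"
    and "(s0, t0) \<in> singular_set (I1 \<times> J1) (F1 G \<xi> \<mu>)"
    and "(deriv ^^ 3) \<xi> t0
         + deriv (\<lambda>t. ((\<lambda>(x, y, z, p, q). x * (D_q \<alpha> (x, y, z, p, q)
               + \<alpha> (x, y, z, p, q) * D_p \<alpha> (x, y, z, p, q)))
             \<circ> Theta1 G \<xi> \<mu>) (s0, t)) t0 \<noteq> 0"
  shows "cuspidal_edge_at (F1 G \<xi> \<mu>) (s0, t0)"
proof -
  note a = assms
  define h where "h n s t = (deriv ^^ n) \<xi> t + s * (deriv ^^ n) \<mu> t" for n s t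
  have st: "s0 \<in> I1" "t0 \<in> J1" using a(14) by (auto simp: singular_set_def)
  have o: "open (I1 \<times> J1)" "(s0, t0) \<in> I1 \<times> J1" using a(6,8) st by (auto intro: open_Times)
  have h_d: "(h n s has_real_derivative h (Suc n) s t) (at t)" if "t \<in> J1" for n s t
    using smooth_on_deriv[OF smooth_on_deriv_funpow[OF a(8,10)] that] smooth_on_deriv[OF smooth_on_deriv_funpow[OF a(8,11)] that]
    unfolding h_def by (auto intro!: derivative_eq_intros)
  have h_s: "smooth_on (I1 \<times> J1) (\<lambda>q. h n (fst q) (snd q))" for n
    unfolding h_def
    by (intro smooth_on_intros o smooth_on_compose[OF o(1) a(8) smooth_on_deriv_funpow[OF a(8,10)]]
        smooth_on_compose[OF o(1) a(8) smooth_on_deriv_funpow[OF a(8,11)]]) auto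
  \<comment> \<open>The differential equation for \<mu> together with constancy along the slice
    gives this value for every \<open>s\<close>.\<close>
  have \<mu>': "\<alpha> (G (lift1 \<xi> \<mu> (s, t))) = deriv \<mu> t" if "s \<in> I1" "t \<in> J1" for s t
    using alpha_bar_eq[OF a(2,1,3,4,5), of s "(- deriv \<xi> t, \<xi> t, \<mu> t, t)"] a(12)[OF that] DERIV_imp_deriv[OF a(13)[OF that(2)]]
    by simp
  \<comment> \<open>With \<alpha> equal to \<mu>', the point formula gives y = - \<xi>' - s \<mu>'
    and z = \<xi> + s \<mu> + t y.\<close>
  have \<Theta>: "Theta1 G \<xi> \<mu> (s, t) = (s, - h 1 s t, h 0 s t - t * h 1 s t, \<mu> t, t)" "Theta1 G \<xi> \<mu> (s, t) \<in> D"
    if "s \<in> I1" "t \<in> J1" for s t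
    using local_inverse_Phi1_point[OF a(5), of s "- deriv \<xi> t" "\<xi> t" "\<mu> t" t] a(12)[OF that] \<mu>'[OF that]
    by (simp_all add: Theta1_def h_def algebra_simps)
  have F: "F1 G \<xi> \<mu> (s, t) = (s, - h 1 s t, h 0 s t - t * h 1 s t)" if "(s, t) \<in> I1 \<times> J1" for s t
    using \<Theta>[of s t] that by (simp add: F1_def phi1_def psi1_def Theta1_def)
  have F_s: "smooth_on (I1 \<times> J1) (F1 G \<xi> \<mu>)"
  proof (rule smooth_on_cong[OF o(1)])
    show "smooth_on (I1 \<times> J1) (\<lambda>q. (fst q, - h 1 (fst q) (snd q), h 0 (fst q) (snd q) - snd q * h 1 (fst q) (snd q)))"
      by (intro smooth_on_intros h_s o)
  qed (use F in auto)
  have h2: "h 2 s0 t0 = 0"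
  proof -
    have "((\<lambda>t. - h 1 s0 t) has_real_derivative - h 2 s0 t0) (at t0)"
      using DERIV_minus[OF h_d[OF st(2), of 1 s0]] by (simp add: numeral_2_eq_2)
    then have "((\<lambda>t. fst (snd (F1 G \<xi> \<mu> (s0, t)))) has_real_derivative - h 2 s0 t0) (at t0)"
      by (rule has_field_derivative_transform_within_open[OF _ a(8) st(2)]) (use F st in auto)
    from developable_singular[OF o F_s _ this] show ?thesis
      using a(14) F by (auto simp: singular_set_def)
  qed
  have h3: "h 3 s0 t0 \<noteq> 0"
  proof
    assume h3: "h 3 s0 t0 = 0"
    define \<theta> where "\<theta> t = Theta1 G \<xi> \<mu> (s0, t)" for t
    define E where "E t = ((\<lambda>(x, y, z, p, q). x * (D_q \<alpha> (x, y, z, p, q) + \<alpha> (x, y, z, p, q) * D_p \<alpha> (x, y, z, p, q))) \<circ> Theta1 G \<xi> \<mu>) (s0, t)" for t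
    \<comment> \<open>This is \<open>\<alpha>\<^sub>y + q * \<alpha>\<^sub>z\<close> along the
      curve, where q = t; the Frechet form makes its smoothness in \<open>t\<close>
      available.\<close>
    define B where "B t = frechet_derivative \<alpha> (at (\<theta> t)) (0, 1, 0, 0, 0) + t * frechet_derivative \<alpha> (at (\<theta> t)) (0, 0, 1, 0, 0)" for t
    have \<theta>: "\<theta> t = (s0, - h 1 s0 t, h 0 s0 t - t * h 1 s0 t, \<mu> t, t)" "\<theta> t \<in> D" if "t \<in> J1" for t
      using \<Theta>[OF st(1) that] by (simp_all add: \<theta>_def)
    have h_s1: "smooth_on J1 (h n s0)" for n
      unfolding h_def[abs_def] by (intro smooth_on_intros smooth_on_deriv_funpow a)
    have "smooth_on J1 (\<lambda>t. (s0, - h 1 s0 t, h 0 s0 t - t * h 1 s0 t, \<mu> t, t))"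
      by (intro smooth_on_intros h_s1 a)
    then have \<theta>_s: "smooth_on J1 \<theta>"
      by (rule smooth_on_cong[OF a(8), rotated]) (use \<theta> in auto)
    have "smooth_on J1 B" unfolding B_def[abs_def]
      by (intro smooth_on_intros a(8) smooth_on_compose[OF a(8,1) smooth_on_frechet_derivative[OF a(2)] \<theta>_s] \<theta>(2))
    then have B': "(B has_real_derivative deriv B t0) (at t0)" by (rule smooth_on_deriv[OF _ st(2)])
    \<comment> \<open>The t-derivative of \<alpha> along the curve, which equals \<mu>'', expresses
      \<open>\<alpha>\<^sub>q + \<alpha> * \<alpha>\<^sub>p\<close> as \<mu>'' plus
      \<open>h 2\<close> times \<open>B\<close>; multiplying by \<open>s0\<close> and using
      \<open>s0 * \<mu>'' = h 2 - \<xi>''\<close> gives the identity.\<close>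
    have E: "E t = (1 + s0 * B t) * h 2 s0 t - (deriv ^^ 2) \<xi> t" if t: "t \<in> J1" for t
    proof -
      let ?P = "(s0, - h 1 s0 t, h 0 s0 t - t * h 1 s0 t, \<mu> t, t)"
      have P: "?P \<in> D" using \<theta>[OF t] by simp
      have Bt: "B t = D_y \<alpha> ?P + t * D_z \<alpha> ?P"
        by (simp only: B_def \<theta>(1)[OF t] jet_partial_derivatives[OF a(2) P])
      have d1: "((\<lambda>t. - h 1 s0 t) has_real_derivative - h 2 s0 t) (at t)"
        using DERIV_minus[OF h_d[OF t, of 1 s0]] by (simp add: numeral_2_eq_2)
      have d0: "((\<lambda>t. h 0 s0 t - t * h 1 s0 t) has_real_derivative - (t * h 2 s0 t)) (at t)"
        using h_d[OF t, of 0 s0] h_d[OF t, of 1 s0] by (auto intro!: derivative_eq_intros simp: numeral_2_eq_2)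
      have "((\<lambda>t. \<alpha> (s0, - h 1 s0 t, h 0 s0 t - t * h 1 s0 t, \<mu> t, t)) has_real_derivative
          0 * D_x \<alpha> ?P + - h 2 s0 t * D_y \<alpha> ?P + - (t * h 2 s0 t) * D_z \<alpha> ?P + deriv \<mu> t * D_p \<alpha> ?P + 1 * D_q \<alpha> ?P) (at t)"
        by (rule DERIV_jet[OF a(2)]) (use P d1 d0 smooth_on_deriv[OF a(11) t] in auto)
      then have "(deriv \<mu> has_real_derivative
          0 * D_x \<alpha> ?P + - h 2 s0 t * D_y \<alpha> ?P + - (t * h 2 s0 t) * D_z \<alpha> ?P + deriv \<mu> t * D_p \<alpha> ?P + 1 * D_q \<alpha> ?P) (at t)"
        by (rule has_field_derivative_transform_within_open[OF _ a(8) t])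
           (use \<theta>(1) \<mu>'[OF st(1)] in \<open>auto simp: \<theta>_def Theta1_def simp del: lift1.simps\<close>)
      from DERIV_imp_deriv[OF this]
      have m: "D_q \<alpha> ?P + deriv \<mu> t * D_p \<alpha> ?P = deriv (deriv \<mu>) t + h 2 s0 t * B t"
        by (simp add: Bt algebra_simps)
      have "E t = s0 * (D_q \<alpha> ?P + deriv \<mu> t * D_p \<alpha> ?P)"
        using \<Theta>(1)[OF st(1) t] \<mu>'[OF st(1) t] by (simp add: E_def Theta1_def del: lift1.simps)
      moreover have "(deriv ^^ 2) \<xi> t = h 2 s0 t - s0 * deriv (deriv \<mu>) t" by (simp add: h_def numeral_2_eq_2)
      ultimately show ?thesis unfolding m by (simp add: algebra_simps)
    qed
    \<comment> \<open>Both \<open>h 2\<close> and its derivative vanish at \<open>t0\<close>, so the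
      product contributes nothing, whatever the derivative of \<open>B\<close> is.\<close>
    have "((\<lambda>t. (1 + s0 * B t) * h 2 s0 t - (deriv ^^ 2) \<xi> t) has_real_derivative - (deriv ^^ 3) \<xi> t0) (at t0)"
    proof -
      have "(h 2 s0 has_real_derivative 0) (at t0)" using h_d[OF st(2), of 2 s0] h3 by (simp add: numeral_2_eq_2 numeral_3_eq_3)
      moreover have "((deriv ^^ 2) \<xi> has_real_derivative (deriv ^^ 3) \<xi> t0) (at t0)"
        using smooth_on_deriv[OF smooth_on_deriv_funpow[OF a(8,10), of 2] st(2)] by (simp add: numeral_2_eq_2 numeral_3_eq_3)
      ultimately show ?thesis
        using B' h2 by (auto intro!: derivative_eq_intros)
    qed
    then have "(E has_real_derivative - (deriv ^^ 3) \<xi> t0) (at t0)"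
      by (rule has_field_derivative_transform_within_open[OF _ a(8) st(2)]) (use E in simp)
    then have "deriv E t0 = - (deriv ^^ 3) \<xi> t0" by (rule DERIV_imp_deriv)
    then show False using a(15) unfolding E_def[abs_def] by simp
  qed
  show ?thesis
    by (rule cuspidal_edge_developable[OF a(8,10,11) st(2) _ _ o]) (use h2 h3 F in \<open>auto simp: h_def\<close>)
qed

end
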